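(* Let $\mathbb K$ be a field and $r$ a positive integer. (a) Let $\mathbf a$ and $\mathbf b$ be two $r$-sequences over $\mathbb K$, with $\mathbf a$ C-finite and $\mathbf b$ rational (respectively C-finite). Then their product $\mathbf a\mathbf b:=(a_{\mathbf n}b_{\mathbf n})_{\mathbf n=(n_1,\dots,n_r)}$ is rational (respectively C-finite). (b) Suppose $r\ge2$. If $\mathbf a$ is a rational $r$-sequence over $\mathbb K$ and for each $(r-1)$-tuple $(n_1,\dots,n_{r-1})$ only finitely many $a_{n_1,\dots,n_r}$ are non-zero, then the $(r-1)$-sequence $\mathbf a'\in\mathbb K^{\mathbb N^{r-1}}$ given by $a'_{n_1,\dots,n_{r-1}}=\sum_{n_r}a_{n_1,\dots,n_r}$ is rational. (c) If $\mathbf a$ is a rational $2$-sequence over $\mathbb K$ such that for each $m$ the number of non-zero $a_{m,n}$ is finite, and $\mathbf b$ is a rational sequence over $\mathbb K$, then the sequence $(\mathbf a\bullet\mathbf b)_m:=\sum_na_{m,n}b_n$ is rational. (d) If $\mathbf a$ is a rational (respectively C-finite) $r$-sequence over $\mathbb K$, then so is the $r$-sequence $\mathbf b$ given by $b_{n_1,\dots,n_r}=\sum_{i=0}^{n_1}a_{i,n_2,\dots,n_r}$. (e) If $\mathbf a$ is a rational (respectively C-finite) $r$-sequence over $\mathbb K$ and $d$ is a positive integer, then so is the $r$-sequence $\mathbf b$ given by $b_{n_1,\dots,n_r}=a_{dn_1,n_2,\dots,n_r}$.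
   Context: $\mathbb N=\mathbb Z_{\ge0}$. An $r$-sequence over $\mathbb K$ (for a positive integer $r$) is an element $\mathbf a=(a_{\mathbf n})_{\mathbf n\in\mathbb N^r}$ of $\mathbb K^{\mathbb N^r}$; for $r=1$ it is simply called a sequence. Its Hilbert series is $H_{\mathbf a}(t_1,\dots,t_r)=\sum_{\mathbf n}a_{\mathbf n}t_1^{n_1}\cdots t_r^{n_r}$. The shift $S_i$ ($1\le i\le r$) acts on $r$-sequences by $(S_i\mathbf a)_{n_1,\dots,n_r}=a_{n_1,\dots,n_i+1,\dots,n_r}$, and $S^{\mathbf n}=S_1^{n_1}\cdots S_r^{n_r}$. The $r$-sequence $\mathbf a$ is rational if $H_{\mathbf a}$ is rational, i.e. of the form $P/Q$ with $P,Q\in\mathbb K[t_1,\dots,t_r]$. It is C-finite if the subspace of $\mathbb K^{\mathbb N^r}$ spanned by all shifts $S^{\mathbf n}\mathbf a$, $\mathbf n\in\mathbb N^r$, is finite-dimensional; equivalently, if $H_{\mathbf a}$ is of the form $P(t_1,\dots,t_r)/(Q_1(t_1)\cdots Q_r(t_r))$ with $P$ an $r$-variable polynomial and the $Q_i$ single-variable polynomials over $\mathbb K$. *)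

theory Defs
  imports Complex_Main "HOL-Library.Poly_Mapping" "HOL-Library.Function_Algebras"
begin

text \<open>
  An \<open>r\<close>-tuple of natural numbers \<open>(n\<^sub>1, \<dots>, n\<^sub>r)\<close> is a finitely supported function
  \<open>n :: nat \<Rightarrow>\<^sub>0 nat\<close> with support in \<open>{0, \<dots>, r - 1}\<close>; its coordinate
  \<open>n\<^sub>i\<close> is \<open>lookup n (i - 1)\<close>, so positions are counted from 0. The tuple is
  also the exponent of the monomial in \<open>t\<^sub>1, \<dots>, t\<^sub>r\<close>.
\<close>

definition tuples :: "nat \<Rightarrow> (nat \<Rightarrow>\<^sub>0 nat) set" where
  "tuples r = {n. Poly_Mapping.keys n \<subseteq> {..<r}}"

text \<open>
  \<open>rseqs r\<close> is \<open>K\<close> to the power \<open>\<nat>\<^sup>r\<close>, realised by extending by 0 outside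
  \<open>tuples r\<close>. The values of an \<open>r\<close>-sequence are the coefficients of its Hilbert series,
  so that \<open>rseqs r\<close> is also the ring of formal power series in \<open>r\<close> variables.
\<close>

definition rseqs :: "nat \<Rightarrow> ((nat \<Rightarrow>\<^sub>0 nat) \<Rightarrow> 'k::field) set" where
  "rseqs r = {a. \<forall>n. n \<notin> tuples r \<longrightarrow> a n = 0}"

text \<open>
  Polynomials are elements of the library's convolution ring on \<open>(nat \<Rightarrow>\<^sub>0 nat) \<Rightarrow>\<^sub>0 'k\<close>.
\<close>

definition polys :: "nat \<Rightarrow> ((nat \<Rightarrow>\<^sub>0 nat) \<Rightarrow>\<^sub>0 'k::field) set" where
  "polys r = {P. Poly_Mapping.keys P \<subseteq> tuples r}"

lemma finite_add_decomps: "finite {(k, l). k + l = (n :: nat \<Rightarrow>\<^sub>0 nat)}"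
proof -
  let ?N = "Max (insert 0 (Poly_Mapping.lookup n ` Poly_Mapping.keys n))"
  let ?F = "{f. \<forall>i. (i \<in> Poly_Mapping.keys n \<longrightarrow> f i \<in> {..?N}) \<and>
                   (i \<notin> Poly_Mapping.keys n \<longrightarrow> f i = (0::nat))}"
  have fin: "finite ?F"
    by (rule finite_set_of_finite_funs) auto
  have le: "Poly_Mapping.lookup n i \<le> ?N" if "i \<in> Poly_Mapping.keys n" for i
    using that by (intro Max_ge) auto
  have in_F: "Poly_Mapping.lookup k \<in> ?F" if "k + l = n" for k l
  proof -
    have k_le: "Poly_Mapping.lookup k i \<le> Poly_Mapping.lookup n i" for i
      using that by (auto simp: lookup_add)
    have "Poly_Mapping.lookup k i = 0" if "i \<notin> Poly_Mapping.keys n" for i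
      using k_le[of i] that by (simp add: in_keys_iff)
    then show ?thesis
      using order_trans[OF k_le le] by blast
  qed
  have "inj_on (\<lambda>(k, l). Poly_Mapping.lookup k) {(k, l). k + l = n}"
    by (auto simp: inj_on_def poly_mapping.lookup_inject)
  moreover have "(\<lambda>(k, l). Poly_Mapping.lookup k) ` {(k, l). k + l = n} \<subseteq> ?F"
  proof (rule image_subsetI)
    fix p assume "p \<in> {(k, l). k + l = n}"
    then have "fst p + snd p = n" by auto
    from in_F[OF this] show "(\<lambda>(k, l). Poly_Mapping.lookup k) p \<in> ?F"
      by (simp only: case_prod_unfold)
  qed
  ultimately show ?thesis
    using fin by (meson finite_imageD finite_subset)
qed

text \<open>Cauchy product of formal power series; the sum is finite by the previous lemma.\<close>

definition series_mult ::
    "((nat \<Rightarrow>\<^sub>0 nat) \<Rightarrow> 'k::field) \<Rightarrow> ((nat \<Rightarrow>\<^sub>0 nat) \<Rightarrow> 'k) \<Rightarrow> (nat \<Rightarrow>\<^sub>0 nat) \<Rightarrow> 'k" where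
  "series_mult f g n = (\<Sum>(k, l)\<in>{(k, l). k + l = n}. f k * g l)"

text \<open>
  \<open>H = P / Q\<close> in the field of fractions of the power series ring, that is \<open>Q H = P\<close> with
  \<open>Q \<noteq> 0\<close>; the constant term of \<open>Q\<close> is not required to be nonzero.
\<close>

definition rational_rseq :: "nat \<Rightarrow> ((nat \<Rightarrow>\<^sub>0 nat) \<Rightarrow> 'k::field) \<Rightarrow> bool" where
  "rational_rseq r a \<longleftrightarrow> a \<in> rseqs r \<and>
     (\<exists>P\<in>polys r. \<exists>Q\<in>polys r. Q \<noteq> 0 \<and> series_mult (Poly_Mapping.lookup Q) a = Poly_Mapping.lookup P)"

definition shift :: "nat \<Rightarrow> ((nat \<Rightarrow>\<^sub>0 nat) \<Rightarrow> 'k::field) \<Rightarrow> (nat \<Rightarrow>\<^sub>0 nat) \<Rightarrow> 'k" where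
  "shift i a n = a (n + Poly_Mapping.single i 1)"

definition shifts :: "nat \<Rightarrow> (nat \<Rightarrow>\<^sub>0 nat) \<Rightarrow> ((nat \<Rightarrow>\<^sub>0 nat) \<Rightarrow> 'k::field) \<Rightarrow> (nat \<Rightarrow>\<^sub>0 nat) \<Rightarrow> 'k" where
  "shifts r n a = foldr (\<lambda>i. shift i ^^ Poly_Mapping.lookup n i) [0..<r] a"

definition seq_scale :: "'k::field \<Rightarrow> ((nat \<Rightarrow>\<^sub>0 nat) \<Rightarrow> 'k) \<Rightarrow> (nat \<Rightarrow>\<^sub>0 nat) \<Rightarrow> 'k" where
  "seq_scale c a = (\<lambda>n. c * a n)"

interpretation seq: vector_space seq_scale
  by unfold_locales (auto simp: seq_scale_def fun_eq_iff algebra_simps)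

definition cfinite_rseq :: "nat \<Rightarrow> ((nat \<Rightarrow>\<^sub>0 nat) \<Rightarrow> 'k::field) \<Rightarrow> bool" where
  "cfinite_rseq r a \<longleftrightarrow> a \<in> rseqs r \<and>
     (\<exists>B. finite B \<and> seq.span {shifts r n a | n. n \<in> tuples r} = seq.span B)"

end

theory Submission
  imports Defs
begin

text \<open>
  Power series form a module over the polynomial ring, an integral domain, and a series is rational
  if some nonzero polynomial multiple of it is a polynomial. Rational series thus form a submodule
  from which nonzero polynomial factors can be cancelled. The closure properties of rational series
  are reduced to finding, for the series in question, a linear equation over the polynomials.

  For the pointwise product of a C-finite \<open>a\<close> and a rational \<open>b\<close> with \<open>Q b = P\<close>, consider a
  finite-dimensional space \<open>V\<close> that contains \<open>a\<close> and is stable under the shifts. Multiplying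
  \<open>Q b = P\<close> pointwise by \<open>v \<in> V\<close> yields \<open>\<Sum>\<^sub>k Q\<^sub>k t\<^sup>k ((S\<^sup>k v) b) = v P\<close>, where the right-hand side
  is a polynomial. If the shifts are surjective on \<open>V\<close>, then these relations, applied to a spanning set,
  form a square linear system that is governed by the leading monomial of \<open>Q\<close> and therefore regular
  (\<open>hadamard_rational_if_shifts_surjective\<close>). Looking at leading monomials takes the place of
  diagonalising the shifts over an extension of the field. If a shift \<open>S\<^sub>i\<close> is not surjective, the slice of the product at \<open>n\<^sub>i = 0\<close>
  is split off; this leads to a space with fewer bad shifts and to one of smaller dimension
  (\<open>hadamard_rational\<close>). The step uses that slices of rational series are rational
  (\<open>rational_slice\<close>).

  Summation over an index whose fibres are finite is the evaluation at \<open>t\<^sub>i = 1\<close>, which turns an equation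
  \<open>Q f = P\<close> into one for the sum, unless \<open>Q\<close> vanishes at \<open>t\<^sub>i = 1\<close>; in that case the equation is first
  expanded in powers of \<open>t\<^sub>i - 1\<close> and its lowest nontrivial coefficient is taken
  (\<open>rational_moment_0\<close>). The contraction of \<open>a\<close> with \<open>b\<close> is a sum of this kind over a pointwise product with
  a C-finite sequence.

  Partial sums have Hilbert series \<open>H / (1 - t\<^sub>1)\<close>. For the restriction to indices \<open>d n\<^sub>1\<close>, all
  terms whose first index is not a multiple of \<open>d\<close> are first erased by a pointwise product with a periodic
  sequence; the result is a series in \<open>t\<^sub>1\<^sup>d\<close>, and one residue class of the exponents of \<open>t\<^sub>1\<close> in
  \<open>Q f = P\<close> gives the desired equation (\<open>rational_stretch\<close>). The C-finite versions of the statements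
  all consist in exhibiting a finite-dimensional space that is stable under the shifts.
\<close>

type_synonym mon = "nat \<Rightarrow>\<^sub>0 nat"
type_synonym 'k pol = "mon \<Rightarrow>\<^sub>0 'k"

section \<open>Power series as a module over the polynomials\<close>

lemma series_mult_add_left: "series_mult (f + g) h = series_mult f h + series_mult g h"
  by (auto simp: series_mult_def fun_eq_iff algebra_simps sum.distrib case_prod_unfold)

lemma series_mult_add_right: "series_mult f (g + h) = series_mult f g + series_mult f h"
  by (auto simp: series_mult_def fun_eq_iff algebra_simps sum.distrib case_prod_unfold)

lemma series_mult_zero_left [simp]: "series_mult 0 f = 0"
  by (auto simp: series_mult_def fun_eq_iff)

lemma series_mult_zero_right [simp]: "series_mult f 0 = 0"
  by (auto simp: series_mult_def fun_eq_iff)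

lemma series_mult_uminus_right: "series_mult f (- g) = - series_mult f g"
  by (auto simp: series_mult_def fun_eq_iff sum_negf case_prod_unfold)

lemma series_mult_sum_left: "series_mult (\<Sum>i\<in>I. f i) g = (\<Sum>i\<in>I. series_mult (f i) g)"
  by (induction I rule: infinite_finite_induct)
     (simp_all only: sum.infinite sum.empty sum.insert series_mult_add_left series_mult_zero_left not_False_eq_True)

lemma series_mult_sum_right: "series_mult f (\<Sum>i\<in>I. g i) = (\<Sum>i\<in>I. series_mult f (g i))"
  by (induction I rule: infinite_finite_induct)
     (simp_all only: sum.infinite sum.empty sum.insert series_mult_add_right series_mult_zero_right not_False_eq_True)

lemma series_mult_assoc: "series_mult (series_mult f g) h = series_mult f (series_mult g h)"
proof
  fix n :: mon
  let ?T = "\<lambda>m. {(k, l). k + l = (m :: mon)}"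
  have fin: "finite {p. fst p + snd p = m}" for m :: mon
    using finite_add_decomps[of m] by (simp add: case_prod_unfold)
  have "series_mult (series_mult f g) h n
      = (\<Sum>(p, q)\<in>(SIGMA p:?T n. ?T (fst p)). f (fst q) * g (snd q) * h (snd p))"
    by (simp add: series_mult_def sum_distrib_right case_prod_unfold sum.Sigma fin)
  also have "\<dots> = (\<Sum>(p, q)\<in>(SIGMA p:?T n. ?T (snd p)). f (fst p) * (g (fst q) * h (snd q)))"
    by (rule sum.reindex_bij_witness[of _
          "\<lambda>(p, q). ((fst p + fst q, snd q), (fst p, fst q))"
          "\<lambda>(p, q). ((fst q, snd q + snd p), (snd q, snd p))"])
       (auto simp: add.assoc mult.assoc)
  also have "\<dots> = series_mult f (series_mult g h) n"
    by (simp add: series_mult_def sum_distrib_left case_prod_unfold sum.Sigma fin)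
  finally show "series_mult (series_mult f g) h n = series_mult f (series_mult g h) n" .
qed

text \<open>
  Polynomials act on power series through \<^const>\<open>series_mult\<close>, and by this identity the action is
  compatible with the library's product of polynomials. Power series thereby form a module over
  the integral domain of polynomials.
\<close>

lemma lookup_mult_eq_series_mult:
  "Poly_Mapping.lookup (P * Q) = series_mult (Poly_Mapping.lookup P) (Poly_Mapping.lookup (Q :: 'k::field pol))"
proof
  fix n
  let ?f = "Poly_Mapping.lookup P" and ?g = "Poly_Mapping.lookup Q"
  have "Poly_Mapping.lookup (P * Q) n = prod_fun ?f ?g n"
    by (simp add: times_poly_mapping.rep_eq)
  also have "\<dots> = (\<Sum>(a, b). ?f a * ?g b when n = a + b)"
    by (rule prod_fun_unfold_prod) auto
  also have "\<dots> = (\<Sum>(a, b)\<in>{(k, l). k + l = n}. ?f a * ?g b when n = a + b)"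
    by (rule Sum_any.expand_superset[OF finite_add_decomps]) (auto simp: when_def split: if_splits)
  also have "\<dots> = series_mult ?f ?g n"
    unfolding series_mult_def by (rule sum.cong) auto
  finally show "Poly_Mapping.lookup (P * Q) n = series_mult ?f ?g n" .
qed

lemma lookup_plus_fun: "Poly_Mapping.lookup (P + Q) = Poly_Mapping.lookup P + Poly_Mapping.lookup Q"
  by (auto simp: lookup_add)

lemma lookup_uminus_fun: "Poly_Mapping.lookup (- P) = - Poly_Mapping.lookup P"
  by auto

lemma lookup_zero_fun: "Poly_Mapping.lookup 0 = 0"
  by auto

lemma sum_apply: "(\<Sum>i\<in>I. f i) x = (\<Sum>i\<in>I. f i x)"
  for f :: "'i \<Rightarrow> 'x \<Rightarrow> 'k::comm_monoid_add"
  by (induction I rule: infinite_finite_induct) auto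

lemma lookup_sum_fun: "Poly_Mapping.lookup (\<Sum>i\<in>I. P i) = (\<Sum>i\<in>I. Poly_Mapping.lookup (P i))"
  by (auto simp: lookup_sum sum_apply fun_eq_iff)

lemma lookup_sum_monomials:
  "Poly_Mapping.lookup Q = (\<Sum>k\<in>Poly_Mapping.keys Q.
     Poly_Mapping.lookup (Poly_Mapping.single k (Poly_Mapping.lookup Q k)))"
proof
  fix n
  have "(\<Sum>k\<in>Poly_Mapping.keys Q. Poly_Mapping.lookup (Poly_Mapping.single k (Poly_Mapping.lookup Q k)) n)
      = (\<Sum>k\<in>Poly_Mapping.keys Q. if k = n then Poly_Mapping.lookup Q k else 0)"
    by (rule sum.cong) (auto simp: lookup_single when_def)
  then show "Poly_Mapping.lookup Q n = (\<Sum>k\<in>Poly_Mapping.keys Q.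
     Poly_Mapping.lookup (Poly_Mapping.single k (Poly_Mapping.lookup Q k))) n"
    by (simp add: sum_apply in_keys_iff)
qed

lemma series_mult_monomials:
  "series_mult (Poly_Mapping.lookup Q) f = (\<Sum>k\<in>Poly_Mapping.keys Q.
     series_mult (Poly_Mapping.lookup (Poly_Mapping.single k (Poly_Mapping.lookup Q k))) f)"
  by (subst lookup_sum_monomials) (rule series_mult_sum_left)

lemma series_mult_single_add:
  "series_mult (Poly_Mapping.lookup (Poly_Mapping.single k c)) f (k + l) = c * f l"
proof -
  have "series_mult (Poly_Mapping.lookup (Poly_Mapping.single k c)) f (k + l)
      = (\<Sum>p\<in>{(k, l)}. case p of (u, v) \<Rightarrow> Poly_Mapping.lookup (Poly_Mapping.single k c) u * f v)"
    unfolding series_mult_def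
    by (rule sum.mono_neutral_right[OF finite_add_decomps]) (auto simp: lookup_single when_def split: if_splits)
  then show ?thesis by simp
qed

lemma series_mult_single_eq_0:
  assumes "\<And>l. n \<noteq> k + l"
  shows "series_mult (Poly_Mapping.lookup (Poly_Mapping.single k c)) f n = 0"
  unfolding series_mult_def using assms by (intro sum.neutral) (auto simp: lookup_single when_def)

lemma finite_support_polynomial:
  assumes "finite {n. f n \<noteq> 0}"
  shows "\<exists>P. Poly_Mapping.lookup P = f"
  using assms lookup_Abs_poly_mapping by blast

section \<open>Rational series\<close>

text \<open>
  The rational series are the elements that become torsion in the quotient of the module of power
  series by the polynomials. They hence form a submodule from which a nonzero polynomial factor can
  be cancelled, which is how they are used throughout. The number of variables is left open; that
  nothing is lost by this is shown in \<open>rational_rseq_iff\<close>.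
\<close>

definition rational :: "(mon \<Rightarrow> 'k::field) \<Rightarrow> bool" where
  "rational f \<longleftrightarrow> (\<exists>P Q. Q \<noteq> 0 \<and> series_mult (Poly_Mapping.lookup Q) f = Poly_Mapping.lookup P)"

lemma rational_lookup: "rational (Poly_Mapping.lookup P)"
  unfolding rational_def
  by (rule exI[of _ P], rule exI[of _ 1]) (simp flip: lookup_mult_eq_series_mult)

lemma rational_add:
  assumes "rational f" "rational g"
  shows "rational (f + g)"
proof -
  obtain P Q P' Q' where *: "Q \<noteq> 0" "series_mult (Poly_Mapping.lookup Q) f = Poly_Mapping.lookup P"
    "Q' \<noteq> 0" "series_mult (Poly_Mapping.lookup Q') g = Poly_Mapping.lookup P'"
    using assms unfolding rational_def by blast
  have "series_mult (Poly_Mapping.lookup (Q' * Q)) f = Poly_Mapping.lookup (Q' * P)"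
    using * by (simp add: lookup_mult_eq_series_mult series_mult_assoc)
  moreover have "series_mult (Poly_Mapping.lookup (Q' * Q)) g = Poly_Mapping.lookup (Q * P')"
    using * by (subst mult.commute) (simp add: lookup_mult_eq_series_mult series_mult_assoc)
  ultimately have "series_mult (Poly_Mapping.lookup (Q' * Q)) (f + g) = Poly_Mapping.lookup (Q' * P + Q * P')"
    by (simp add: series_mult_add_right lookup_plus_fun)
  moreover have "Q' * Q \<noteq> 0" using * by simp
  ultimately show ?thesis unfolding rational_def by blast
qed

lemma rational_uminus: "rational f \<Longrightarrow> rational (- f)"
  unfolding rational_def by (metis series_mult_uminus_right lookup_uminus_fun)

lemma rational_diff: "rational f \<Longrightarrow> rational g \<Longrightarrow> rational (f - g)"
  using rational_add[of f "- g"] rational_uminus by auto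

lemma rational_zero: "rational 0"
  using rational_lookup[of 0] by (simp add: lookup_zero_fun)

lemma rational_sum: "(\<And>i. i \<in> I \<Longrightarrow> rational (f i)) \<Longrightarrow> rational (\<Sum>i\<in>I. f i)"
  by (induction I rule: infinite_finite_induct) (auto intro: rational_add rational_zero)

lemma rational_series_mult:
  assumes "rational f"
  shows "rational (series_mult (Poly_Mapping.lookup R) f)"
proof -
  obtain P Q where *: "Q \<noteq> 0" "series_mult (Poly_Mapping.lookup Q) f = Poly_Mapping.lookup P"
    using assms unfolding rational_def by blast
  have "series_mult (Poly_Mapping.lookup Q) (series_mult (Poly_Mapping.lookup R) f)
      = series_mult (Poly_Mapping.lookup (Q * R)) f"
    by (simp add: lookup_mult_eq_series_mult series_mult_assoc)
  also have "\<dots> = Poly_Mapping.lookup (R * P)"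
    by (subst mult.commute) (simp add: * lookup_mult_eq_series_mult series_mult_assoc)
  finally show ?thesis using * unfolding rational_def by blast
qed

lemma rational_cancel:
  assumes "rational (series_mult (Poly_Mapping.lookup R) f)" "R \<noteq> 0"
  shows "rational f"
proof -
  obtain P Q where *: "Q \<noteq> 0"
    "series_mult (Poly_Mapping.lookup Q) (series_mult (Poly_Mapping.lookup R) f) = Poly_Mapping.lookup P"
    using assms unfolding rational_def by blast
  then have "series_mult (Poly_Mapping.lookup (Q * R)) f = Poly_Mapping.lookup P"
    by (simp add: lookup_mult_eq_series_mult series_mult_assoc)
  moreover have "Q * R \<noteq> 0" using assms * by simp
  ultimately show ?thesis unfolding rational_def by blast
qed

lemma rational_scale: "rational f \<Longrightarrow> rational (seq_scale c f)"
proof -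
  have "seq_scale c f = series_mult (Poly_Mapping.lookup (Poly_Mapping.single 0 c)) f"
    using series_mult_single_add[of 0 c f] by (auto simp: seq_scale_def fun_eq_iff)
  then show "rational f \<Longrightarrow> rational (seq_scale c f)" by (simp add: rational_series_mult)
qed

section \<open>Shifts\<close>

lemma module_hom_shift: "module_hom seq_scale seq_scale (shift i)"
  by unfold_locales (auto simp: shift_def seq_scale_def fun_eq_iff)

lemma funpow_shift: "(shift i ^^ m) f n = f (n + Poly_Mapping.single i m)"
proof (induction m arbitrary: n)
  case (Suc m)
  have "(shift i ^^ Suc m) f n = f (n + Poly_Mapping.single i 1 + Poly_Mapping.single i m)"
    unfolding Suc[of "n + Poly_Mapping.single i 1", symmetric] by (simp add: shift_def)
  then show ?case by (simp add: add.assoc flip: single_add)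
qed simp

lemma foldr_shift:
  "foldr (\<lambda>i. shift i ^^ Poly_Mapping.lookup n i) xs f m
     = f (m + (\<Sum>i\<leftarrow>xs. Poly_Mapping.single i (Poly_Mapping.lookup n i)))"
  by (induction xs arbitrary: m) (auto simp: funpow_shift add_ac)

lemma tuple_eq_sum_single:
  assumes "n \<in> tuples r"
  shows "(\<Sum>i\<leftarrow>[0..<r]. Poly_Mapping.single i (Poly_Mapping.lookup n i)) = n"
proof (rule poly_mapping_eqI)
  fix j
  have "Poly_Mapping.lookup (\<Sum>i\<in>{0..<r}. Poly_Mapping.single i (Poly_Mapping.lookup n i)) j
      = (\<Sum>i\<in>{0..<r}. if i = j then Poly_Mapping.lookup n i else 0)"
    unfolding lookup_sum by (rule sum.cong) (auto simp: lookup_single when_def)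
  also have "\<dots> = Poly_Mapping.lookup n j"
    using assms by (auto simp: tuples_def in_keys_iff)
  finally show "Poly_Mapping.lookup (\<Sum>i\<leftarrow>[0..<r]. Poly_Mapping.single i (Poly_Mapping.lookup n i)) j
      = Poly_Mapping.lookup n j"
    by (simp add: interv_sum_list_conv_sum_set_nat)
qed

lemma shifts_apply: "n \<in> tuples r \<Longrightarrow> shifts r n f m = f (m + n)"
  unfolding shifts_def foldr_shift by (simp add: tuple_eq_sum_single)

lemma funpow_image_subset: "f ` V \<subseteq> V \<Longrightarrow> (f ^^ m) ` V \<subseteq> V"
  by (induction m) auto

lemma funpow_image_eq: "f ` V = V \<Longrightarrow> (f ^^ m) ` V = V"
  by (induction m) (simp_all flip: image_image)

lemma shifts_image_subset:
  assumes "\<And>i. i < r \<Longrightarrow> shift i ` V \<subseteq> V"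
  shows "shifts r n ` V \<subseteq> V"
proof -
  have "foldr (\<lambda>i. shift i ^^ Poly_Mapping.lookup n i) xs ` V \<subseteq> V" if "set xs \<subseteq> {..<r}" for xs
    using that
  proof (induction xs)
    case (Cons i xs)
    then have "foldr (\<lambda>i. shift i ^^ Poly_Mapping.lookup n i) xs ` V \<subseteq> V" by simp
    moreover have "(shift i ^^ Poly_Mapping.lookup n i) ` V \<subseteq> V"
      using Cons.prems by (intro funpow_image_subset assms) auto
    ultimately show ?case by auto
  qed simp
  from this[of "[0..<r]"] show ?thesis unfolding shifts_def by (simp add: lessThan_atLeast0)
qed

lemma shifts_image_eq:
  assumes "\<And>i. i < r \<Longrightarrow> shift i ` V = V"
  shows "shifts r n ` V = V"
proof -
  have "foldr (\<lambda>i. shift i ^^ Poly_Mapping.lookup n i) xs ` V = V" if "set xs \<subseteq> {..<r}" for xs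
    using that
  proof (induction xs)
    case (Cons i xs)
    have "(shift i ^^ Poly_Mapping.lookup n i) ` V = V"
      using Cons.prems by (intro funpow_image_eq assms) auto
    with Cons show ?case by (simp flip: image_image)
  qed simp
  from this[of "[0..<r]"] show ?thesis unfolding shifts_def by (simp add: lessThan_atLeast0)
qed

section \<open>Linear systems with dominant diagonal\<close>

lemma keys_mult_le:
  fixes P Q :: "'k::field pol"
  assumes "Poly_Mapping.keys P \<subseteq> {..m}" "Poly_Mapping.keys Q \<subseteq> {..m'}"
  shows "Poly_Mapping.keys (P * Q) \<subseteq> {..m + m'}"
  using keys_mult[of P Q] assms by (auto intro!: add_mono dest!: subsetD)

lemma keys_mult_less:
  fixes P Q :: "'k::field pol"
  assumes "Poly_Mapping.keys P \<subseteq> {..<m}" "Poly_Mapping.keys Q \<subseteq> {..m'}"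
  shows "Poly_Mapping.keys (P * Q) \<subseteq> {..<m + m'}"
  using keys_mult[of P Q] assms by (auto intro!: add_less_le_mono dest!: subsetD)

lemma lookup_mult_leading:
  fixes P Q :: "'k::field pol"
  assumes "Poly_Mapping.keys P \<subseteq> {..m}" "Poly_Mapping.keys Q \<subseteq> {..m'}"
  shows "Poly_Mapping.lookup (P * Q) (m + m') = Poly_Mapping.lookup P m * Poly_Mapping.lookup Q m'"
proof -
  have eq: "k = m \<and> l = m'"
    if "k + l = m + m'" "Poly_Mapping.lookup P k \<noteq> 0" "Poly_Mapping.lookup Q l \<noteq> 0" for k l
  proof -
    have "k \<le> m" "l \<le> m'" using that assms by (auto simp: in_keys_iff)
    then show ?thesis using that(1)
      by (metis add_le_less_mono add_less_le_mono less_irrefl order_le_less)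
  qed
  have "Poly_Mapping.lookup (P * Q) (m + m')
      = (\<Sum>p\<in>{(m, m')}. case p of (u, v) \<Rightarrow> Poly_Mapping.lookup P u * Poly_Mapping.lookup Q v)"
    unfolding lookup_mult_eq_series_mult series_mult_def
    by (rule sum.mono_neutral_right[OF finite_add_decomps]) (use eq in auto)
  then show ?thesis by simp
qed

lemma keys_diff_subset:
  fixes P Q :: "'k::field pol"
  assumes "Poly_Mapping.keys P \<subseteq> X" "Poly_Mapping.keys Q \<subseteq> X"
  shows "Poly_Mapping.keys (P - Q) \<subseteq> X"
  using assms unfolding subset_iff in_keys_iff lookup_minus by (metis diff_self)

text \<open>
  Cramer's rule in disguise: if the diagonal entries of a square matrix over the polynomials all
  have leading monomial \<open>m\<close> and all other entries only have smaller monomials, then the determinant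
  has leading monomial \<open>m\<close> to the power of the size, so it is nonzero, and a vector that the matrix
  maps to rational series is itself rational. Instead of determinants, one unknown is eliminated at
  a time: the Schur complement of an entry of the diagonal has the same shape, with \<open>m + m\<close> for \<open>m\<close>.
\<close>

lemma rational_if_dominant_system:
  fixes A :: "'i \<Rightarrow> 'i \<Rightarrow> 'k::field pol"
  assumes "finite I"
    and "\<And>i. i \<in> I \<Longrightarrow> rational (\<Sum>j\<in>I. series_mult (Poly_Mapping.lookup (A i j)) (\<phi> j))"
    and "\<And>i. i \<in> I \<Longrightarrow> Poly_Mapping.lookup (A i i) m \<noteq> 0"
    and "\<And>i. i \<in> I \<Longrightarrow> Poly_Mapping.keys (A i i) \<subseteq> {..m}"
    and "\<And>i j. i \<in> I \<Longrightarrow> j \<in> I \<Longrightarrow> i \<noteq> j \<Longrightarrow> Poly_Mapping.keys (A i j) \<subseteq> {..<m}"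
    and "j \<in> I"
  shows "rational (\<phi> j)"
  using assms
proof (induction I arbitrary: A m j rule: finite_induct)
  case (insert k I)
  define A' where "A' i j = A k k * A i j - A i k * A k j" for i j
  let ?S = "\<lambda>P f. series_mult (Poly_Mapping.lookup P) f"
  let ?row = "\<lambda>i. \<Sum>j\<in>insert k I. ?S (A i j) (\<phi> j)"
  have off: "Poly_Mapping.keys (A i j) \<subseteq> {..<m}" if "i \<in> insert k I" "j \<in> insert k I" "i \<noteq> j" for i j
    using insert.prems(4) that by blast
  have le: "Poly_Mapping.keys (A i j) \<subseteq> {..m}" if "i \<in> insert k I" "j \<in> insert k I" for i j
    using insert.prems(3)[of i] off[of i j] that by (cases "i = j") force+
  have S_diff: "?S (P - Q) f = ?S P f - ?S Q f" for P Q :: "'k pol" and f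
    using series_mult_add_left[of "Poly_Mapping.lookup (P - Q)" "Poly_Mapping.lookup Q" f]
    by (simp flip: lookup_plus_fun)
  have rat: "rational (\<phi> j)" if "j \<in> I" for j
  proof (rule insert.IH[OF _ _ _ _ that, where A = A' and m = "m + m"])
    fix i assume i: "i \<in> I"
    with insert.hyps have ik: "i \<noteq> k" by auto
    have sumS: "?S R (?row i') = ?S (R * A i' k) (\<phi> k) + (\<Sum>j\<in>I. ?S (R * A i' j) (\<phi> j))" for R i'
      unfolding series_mult_sum_right lookup_mult_eq_series_mult series_mult_assoc
      by (rule sum.insert[OF insert.hyps])
    have "?S (A k k) (?row i) - ?S (A i k) (?row k)
        = (\<Sum>j\<in>I. ?S (A k k * A i j) (\<phi> j)) - (\<Sum>j\<in>I. ?S (A i k * A k j) (\<phi> j))"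
      unfolding sumS mult.commute[of "A i k" "A k k"] by (rule add_diff_cancel_left)
    also have "\<dots> = (\<Sum>j\<in>I. ?S (A' i j) (\<phi> j))"
      unfolding A'_def S_diff by (rule sum_subtractf[symmetric])
    finally have "(\<Sum>j\<in>I. ?S (A' i j) (\<phi> j)) = ?S (A k k) (?row i) - ?S (A i k) (?row k)"
      by (rule sym)
    then show "rational (\<Sum>j\<in>I. ?S (A' i j) (\<phi> j))"
      using insert.prems(1) i by (auto intro!: rational_diff rational_series_mult simp del: sum.insert)
    have small: "Poly_Mapping.keys (A i k * A k j) \<subseteq> {..<m + m}" if "j \<in> I" for j
      using off[of i k] le[of k j] i ik that by (intro keys_mult_less) auto
    have "Poly_Mapping.lookup (A i k * A k i) (m + m) = 0"
      using small[OF i] by (auto simp: in_keys_iff subset_iff)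
    then show "Poly_Mapping.lookup (A' i i) (m + m) \<noteq> 0"
      using lookup_mult_leading[OF le[of k k] le[of i i]] insert.prems(2) i
      by (simp add: A'_def lookup_minus)
    show "Poly_Mapping.keys (A' i i) \<subseteq> {..m + m}"
      unfolding A'_def using small[OF i] le i
      by (intro keys_diff_subset keys_mult_le) (auto intro: order_less_imp_le)
    show "Poly_Mapping.keys (A' i j) \<subseteq> {..<m + m}" if "j \<in> I" "i \<noteq> j" for j
      unfolding A'_def
    proof (intro keys_diff_subset small that)
      show "Poly_Mapping.keys (A k k * A i j) \<subseteq> {..<m + m}"
        using keys_mult_less[OF off[of i j] le[of k k]] i that by (simp add: mult.commute)
    qed
  qed
  have eq: "?S (A k k) (\<phi> k) = ?row k - (\<Sum>j\<in>I. ?S (A k j) (\<phi> j))"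
    unfolding sum.insert[OF insert.hyps] by (rule add_diff_cancel_right'[symmetric])
  have "rational (?S (A k k) (\<phi> k))"
    unfolding eq
  proof (rule rational_diff)
    show "rational (?row k)" by (rule insert.prems(1)) simp
    show "rational (\<Sum>j\<in>I. ?S (A k j) (\<phi> j))" by (intro rational_sum rational_series_mult rat)
  qed
  then have "rational (\<phi> k)"
    using insert.prems(2)[of k] by (intro rational_cancel[of "A k k" "\<phi> k"]) auto
  with rat show ?case using insert.prems(5) by auto
qed simp

section \<open>Pointwise products when the shifts are surjective\<close>

lemma times_eq_lambda: "f * g = (\<lambda>n. f n * g n)" for f g :: "mon \<Rightarrow> 'k::field"
  by (simp add: fun_eq_iff)

lemma rational_pointwise_mult_lookup: "rational (v * Poly_Mapping.lookup P)"
proof -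
  have "finite {n. (v * Poly_Mapping.lookup P) n \<noteq> 0}"
    by (rule finite_subset[OF _ finite_keys[of P]]) (auto simp: in_keys_iff)
  from finite_support_polynomial[OF this] show ?thesis
    using rational_lookup by metis
qed

text \<open>
  The link between the two products. Multiplying \<open>b\<close> by the monomial \<open>k\<close> moves its coefficients by
  \<open>k\<close>, so before the move they meet the values of \<open>v\<close> that lie \<open>k\<close> further on.
\<close>

lemma pointwise_mult_single:
  "v * series_mult (Poly_Mapping.lookup (Poly_Mapping.single k c)) b
     = series_mult (Poly_Mapping.lookup (Poly_Mapping.single k c)) ((\<lambda>l. v (l + k)) * b)" (is "?l = ?r")
proof
  fix n
  show "?l n = ?r n"
  proof (cases "\<exists>l. n = k + l")
    case True
    then obtain l where n: "n = k + l" by blast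
    show ?thesis unfolding n times_fun_apply series_mult_single_add by (simp add: add.commute)
  next
    case False
    then show ?thesis by (simp add: series_mult_single_eq_0)
  qed
qed

lemma module_hom_times: "module_hom seq_scale seq_scale (\<lambda>v. v * b)"
  by unfold_locales (auto simp: seq_scale_def fun_eq_iff algebra_simps)

lemma span_finiteE:
  assumes "finite B" "v \<in> seq.span B"
  obtains c where "v = (\<Sum>w\<in>B. seq_scale (c w) w)"
  using assms by (auto simp: seq.span_finite)

lemma series_mult_single_scale:
  "series_mult (Poly_Mapping.lookup (Poly_Mapping.single k (q * c))) f
     = series_mult (Poly_Mapping.lookup (Poly_Mapping.single k q)) (seq_scale c f)" (is "?l = ?r")
proof
  fix n
  show "?l n = ?r n"
  proof (cases "\<exists>l. n = k + l")
    case True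
    then show ?thesis by (auto simp: series_mult_single_add seq_scale_def)
  next
    case False
    then show ?thesis by (simp add: series_mult_single_eq_0)
  qed
qed

text \<open>
  Let \<open>Q b = P\<close>. Multiplying pointwise by any \<open>v\<close> in the span of \<open>B\<close> gives the polynomial \<open>v P\<close> on the right
  and, by \<open>pointwise_mult_single\<close>, the sum of all \<open>Q\<^sub>k t\<^sup>k ((S\<^sup>k v) b)\<close> on the left. Each \<open>S\<^sup>k v\<close> is a
  combination of \<open>B\<close>, so this is a linear relation over the polynomials between the products
  \<open>w b\<close> with \<open>w \<in> B\<close>. Let \<open>m\<close> be the largest exponent of \<open>Q\<close>. As the shifts are surjective, every
  \<open>w \<in> B\<close> can be written as \<open>S\<^sup>m v\<close>; in the relation for this \<open>v\<close> the monomial \<open>m\<close> occurs only in the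
  coefficient of \<open>w b\<close>. The relations thus form a dominant system.
\<close>

lemma hadamard_rational_if_shifts_surjective:
  fixes B :: "(mon \<Rightarrow> 'k::field) set"
  assumes "finite B" and surj: "\<And>i. i < r \<Longrightarrow> shift i ` seq.span B = seq.span B"
    and b: "rational_rseq r b" and v: "v \<in> seq.span B"
  shows "rational (v * b)"
proof -
  let ?S = "\<lambda>P f. series_mult (Poly_Mapping.lookup P) f"
  obtain P Q where Q: "Q \<in> polys r" "Q \<noteq> 0" "?S Q b = Poly_Mapping.lookup P"
    using b unfolding rational_rseq_def by blast
  define q where "q = Poly_Mapping.lookup Q"
  define m where "m = Max (Poly_Mapping.keys Q)"
  have m: "m \<in> Poly_Mapping.keys Q" and m_max: "\<And>k. k \<in> Poly_Mapping.keys Q \<Longrightarrow> k \<le> m"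
    using Q(2) unfolding m_def by (auto intro: Max_in)
  have tup: "k \<in> tuples r" if "k \<in> Poly_Mapping.keys Q" for k
    using Q(1) that by (auto simp: polys_def)
  have image: "shifts r k ` seq.span B = seq.span B" for k
    using surj by (rule shifts_image_eq)
  have "\<forall>w\<in>B. \<exists>u\<in>seq.span B. shifts r m u = w"
    using image[of m] seq.span_superset[of B] by (metis imageE subsetD)
  then obtain pre where pre: "\<And>w. w \<in> B \<Longrightarrow> pre w \<in> seq.span B" "\<And>w. w \<in> B \<Longrightarrow> shifts r m (pre w) = w"
    by metis
  \<comment> \<open>Coordinates of the translates with respect to \<open>B\<close>. As \<open>B\<close> may be linearly dependent, those of \<open>S\<^sup>m (pre w) = w\<close> have to be fixed as the obvious ones.\<close>
  define expands where "expands w k c \<longleftrightarrow> shifts r k (pre w) = (\<Sum>u\<in>B. seq_scale (c u) u) \<and>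
    (k = m \<longrightarrow> c = (\<lambda>u. if u = w then 1 else 0))" for w k and c :: "(mon \<Rightarrow> 'k) \<Rightarrow> 'k"
  have ex: "\<exists>c. expands w k c" if w: "w \<in> B" for w k
  proof (cases "k = m")
    case True
    have "(\<Sum>u\<in>B. seq_scale (if u = w then 1 else 0) u) = (\<Sum>u\<in>B. if u = w then u else 0)"
      by (rule sum.cong) (auto simp: seq_scale_def)
    also have "\<dots> = w" using w assms(1) by (simp add: sum.delta)
    finally show ?thesis using True pre(2)[OF w] unfolding expands_def by auto
  next
    case False
    have "shifts r k (pre w) \<in> seq.span B" using pre(1)[OF w] image[of k] by blast
    then obtain c where "shifts r k (pre w) = (\<Sum>u\<in>B. seq_scale (c u) u)"
      using span_finiteE[OF assms(1)] by blast
    with False show ?thesis unfolding expands_def by blast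
  qed
  define c where "c w k = (SOME c. expands w k c)" for w k
  have "expands w k (c w k)" if "w \<in> B" for w k
    unfolding c_def using ex[OF that] by (rule someI_ex)
  then have c: "\<And>w k. w \<in> B \<Longrightarrow> shifts r k (pre w) = (\<Sum>u\<in>B. seq_scale (c w k u) u)"
    and cm: "\<And>w u. w \<in> B \<Longrightarrow> c w m u = (if u = w then 1 else 0)"
    unfolding expands_def by auto
  define A where "A w u = (\<Sum>k\<in>Poly_Mapping.keys Q. Poly_Mapping.single k (q k * c w k u))" for w u
  have lookup_A: "Poly_Mapping.lookup (A w u) k = q k * c w k u" for w u k
  proof -
    have "Poly_Mapping.lookup (A w u) k = (\<Sum>j\<in>Poly_Mapping.keys Q. if j = k then q j * c w j u else 0)"
      unfolding A_def lookup_sum by (rule sum.cong) (auto simp: lookup_single when_def)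
    then show ?thesis by (simp add: q_def in_keys_iff)
  qed
  have row: "rational (\<Sum>u\<in>B. ?S (A w u) (u * b))" if w: "w \<in> B" for w
  proof -
    have "(\<Sum>u\<in>B. ?S (A w u) (u * b))
        = (\<Sum>u\<in>B. \<Sum>k\<in>Poly_Mapping.keys Q. ?S (Poly_Mapping.single k (q k)) (seq_scale (c w k u) (u * b)))"
      by (simp only: A_def lookup_sum_fun series_mult_sum_left series_mult_single_scale)
    also have "\<dots> = (\<Sum>k\<in>Poly_Mapping.keys Q. \<Sum>u\<in>B. ?S (Poly_Mapping.single k (q k)) (seq_scale (c w k u) (u * b)))"
      by (rule sum.swap)
    also have "\<dots> = (\<Sum>k\<in>Poly_Mapping.keys Q. ?S (Poly_Mapping.single k (q k)) (shifts r k (pre w) * b))"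
    proof (rule sum.cong[OF refl])
      fix k assume "k \<in> Poly_Mapping.keys Q"
      interpret hom: module_hom seq_scale seq_scale "\<lambda>v. v * b" by (rule module_hom_times)
      have "shifts r k (pre w) * b = (\<Sum>u\<in>B. seq_scale (c w k u) (u * b))"
        unfolding c[OF w] hom.sum hom.scale ..
      then show "(\<Sum>u\<in>B. ?S (Poly_Mapping.single k (q k)) (seq_scale (c w k u) (u * b)))
          = ?S (Poly_Mapping.single k (q k)) (shifts r k (pre w) * b)"
        by (simp only: series_mult_sum_right)
    qed
    also have "\<dots> = (\<Sum>k\<in>Poly_Mapping.keys Q. pre w * ?S (Poly_Mapping.single k (q k)) b)"
    proof (rule sum.cong[OF refl])
      fix k assume "k \<in> Poly_Mapping.keys Q"
      then have "shifts r k (pre w) = (\<lambda>l. pre w (l + k))" by (auto simp: shifts_apply tup)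
      then show "?S (Poly_Mapping.single k (q k)) (shifts r k (pre w) * b) = pre w * ?S (Poly_Mapping.single k (q k)) b"
        by (simp only: pointwise_mult_single)
    qed
    also have "\<dots> = pre w * ?S Q b"
      unfolding q_def series_mult_monomials[of Q b] by (rule sum_distrib_left[symmetric])
    finally show ?thesis by (simp only: Q(3) rational_pointwise_mult_lookup)
  qed
  have rat: "rational (w * b)" if "w \<in> B" for w
  proof (rule rational_if_dominant_system[OF assms(1) row _ _ _ that, where m = m])
    show "Poly_Mapping.lookup (A u u) m \<noteq> 0" if "u \<in> B" for u
      using m cm[OF that] by (simp add: lookup_A q_def in_keys_iff)
    show "Poly_Mapping.keys (A u u) \<subseteq> {..m}" for u
      using m_max by (auto simp: in_keys_iff lookup_A q_def)
    show "Poly_Mapping.keys (A u u') \<subseteq> {..<m}" if "u \<in> B" "u \<noteq> u'" for u u'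
    proof
      fix k assume "k \<in> Poly_Mapping.keys (A u u')"
      then have "q k \<noteq> 0" "c u k u' \<noteq> 0" by (auto simp: in_keys_iff lookup_A)
      then have "k \<le> m" "k \<noteq> m" using m_max[of k] cm[OF that(1), of u'] that(2) by (auto simp: q_def in_keys_iff)
      then show "k \<in> {..<m}" by auto
    qed
  qed
  obtain d where d: "v = (\<Sum>w\<in>B. seq_scale (d w) w)" using span_finiteE[OF assms(1) v] .
  interpret hom: module_hom seq_scale seq_scale "\<lambda>v. v * b" by (rule module_hom_times)
  show ?thesis unfolding d hom.sum hom.scale by (intro rational_sum rational_scale rat)
qed

section \<open>Slices and shifts of rational series\<close>

definition restrict_to :: "mon set \<Rightarrow> (mon \<Rightarrow> 'k::field) \<Rightarrow> mon \<Rightarrow> 'k" where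
  "restrict_to C f n = (if n \<in> C then f n else 0)"

text \<open>
  Taking a homogeneous component of a product: with \<open>C\<close>, \<open>D\<close>, \<open>E\<close> chosen as suitable layers of the
  monoid of exponents, the part of \<open>f g\<close> in \<open>C\<close> comes only from the part of \<open>f\<close> in \<open>D\<close> and that of \<open>g\<close>
  in \<open>E\<close>.
\<close>

lemma series_mult_restrict_to:
  assumes "\<And>k l. f k \<noteq> 0 \<Longrightarrow> g l \<noteq> 0 \<Longrightarrow> k + l \<in> C \<longleftrightarrow> k \<in> D \<and> l \<in> E"
  shows "series_mult (restrict_to D f) (restrict_to E g) = restrict_to C (series_mult f g)"
proof
  fix n
  have "restrict_to D f k * restrict_to E g l = (if n \<in> C then f k * g l else 0)" if "k + l = n" for k l
    using assms[of k l] that by (auto simp: restrict_to_def)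
  then have "series_mult (restrict_to D f) (restrict_to E g) n
      = (\<Sum>(k, l)\<in>{(k, l). k + l = n}. if n \<in> C then f k * g l else 0)"
    unfolding series_mult_def by (intro sum.cong) auto
  then show "series_mult (restrict_to D f) (restrict_to E g) n = restrict_to C (series_mult f g) n"
    by (auto simp: restrict_to_def series_mult_def case_prod_unfold)
qed

lemma restrict_to_lookup: "\<exists>P'. Poly_Mapping.lookup P' = restrict_to C (Poly_Mapping.lookup P)"
  by (rule finite_support_polynomial, rule finite_subset[OF _ finite_keys[of P]])
     (auto simp: restrict_to_def in_keys_iff)

lemma lookup_ne_0_imp_poly_ne_0: "Poly_Mapping.lookup Q k \<noteq> 0 \<Longrightarrow> Q \<noteq> 0"
  by auto

text \<open>
  Setting \<open>t\<^sub>i = 0\<close> in \<open>Q f = P\<close> may lose all information, namely if \<open>t\<^sub>i\<close> divides \<open>Q\<close>. One compares the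
  coefficients of \<open>t\<^sub>i\<^sup>e\<close> instead, where \<open>e\<close> is the least exponent of \<open>t\<^sub>i\<close> in \<open>Q\<close>: only the slice of \<open>f\<close> at
  exponent 0 contributes to it.
\<close>

lemma rational_slice:
  assumes "rational f"
  shows "rational (restrict_to {n. Poly_Mapping.lookup n i = 0} f)"
proof -
  obtain P Q where Q: "Q \<noteq> 0" "series_mult (Poly_Mapping.lookup Q) f = Poly_Mapping.lookup P"
    using assms unfolding rational_def by blast
  define e where "e = Min ((\<lambda>k. Poly_Mapping.lookup k i) ` Poly_Mapping.keys Q)"
  have "e \<in> (\<lambda>k. Poly_Mapping.lookup k i) ` Poly_Mapping.keys Q"
    unfolding e_def using Q(1) by (intro Min_in) auto
  then obtain u where u: "u \<in> Poly_Mapping.keys Q" "Poly_Mapping.lookup u i = e" by blast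
  have e_min: "e \<le> Poly_Mapping.lookup k i" if "Poly_Mapping.lookup Q k \<noteq> 0" for k
    unfolding e_def using that by (intro Min_le) (auto simp: in_keys_iff)
  let ?C = "{n. Poly_Mapping.lookup n i = e}"
  obtain Q' P' where Q': "Poly_Mapping.lookup Q' = restrict_to ?C (Poly_Mapping.lookup Q)"
    and P': "Poly_Mapping.lookup P' = restrict_to ?C (Poly_Mapping.lookup P)"
    using restrict_to_lookup by metis
  have "series_mult (Poly_Mapping.lookup Q') (restrict_to {n. Poly_Mapping.lookup n i = 0} f) = Poly_Mapping.lookup P'"
    unfolding Q' P' Q(2)[symmetric]
    by (rule series_mult_restrict_to) (use e_min in \<open>force simp: lookup_add\<close>)
  moreover have "Poly_Mapping.lookup Q' u \<noteq> 0"
    using u by (simp add: Q' restrict_to_def in_keys_iff)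
  then have "Q' \<noteq> 0" by (rule lookup_ne_0_imp_poly_ne_0)
  ultimately show ?thesis unfolding rational_def by blast
qed

lemma factor_monomial:
  assumes "\<And>n. f n \<noteq> 0 \<Longrightarrow> \<exists>l. n = w + l"
  shows "f = series_mult (Poly_Mapping.lookup (Poly_Mapping.single w 1)) (\<lambda>l. f (w + l))" (is "f = ?g")
proof
  fix n
  show "f n = ?g n"
  proof (cases "\<exists>l. n = w + l")
    case True
    then show ?thesis by (auto simp: series_mult_single_add)
  next
    case False
    then show ?thesis using assms[of n] by (auto simp: series_mult_single_eq_0)
  qed
qed

text \<open>
  \<open>t\<^sub>i S\<^sub>i f\<close> is \<open>f\<close> without its slice at exponent 0.
\<close>

lemma rational_shift:
  fixes f :: "mon \<Rightarrow> 'k::field"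
  assumes "rational f"
  shows "rational (shift i f)"
proof (rule rational_cancel)
  let ?e = "Poly_Mapping.single i (1::nat)"
  let ?h = "f - restrict_to {n. Poly_Mapping.lookup n i = 0} f"
  have h: "?h n = (if Poly_Mapping.lookup n i = 0 then 0 else f n)" for n
    by (simp add: restrict_to_def)
  have "?h = series_mult (Poly_Mapping.lookup (Poly_Mapping.single ?e 1)) (\<lambda>l. ?h (?e + l))"
  proof (rule factor_monomial)
    fix n assume "?h n \<noteq> 0"
    then have "Poly_Mapping.lookup n i \<noteq> 0" unfolding h by (auto split: if_splits)
    then have "n = ?e + (n - ?e)"
      by (intro poly_mapping_eqI) (auto simp: lookup_add lookup_minus lookup_single when_def)
    then show "\<exists>l. n = ?e + l" by blast
  qed
  also have "(\<lambda>l. ?h (?e + l)) = shift i f"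
    unfolding h by (auto simp: shift_def lookup_add add.commute fun_eq_iff)
  finally show "rational (series_mult (Poly_Mapping.lookup (Poly_Mapping.single ?e 1)) (shift i f))"
    using assms by (metis rational_diff rational_slice)
  show "Poly_Mapping.single ?e (1 :: 'k) \<noteq> 0"
    by (rule lookup_ne_0_imp_poly_ne_0[of _ ?e]) simp
qed

lemma tuples_add_iff: "k + l \<in> tuples r \<longleftrightarrow> k \<in> tuples r \<and> l \<in> tuples r"
  by (auto simp: tuples_def in_keys_iff lookup_add subset_iff)

text \<open>
  Given a fraction in arbitrarily many variables for a series \<open>a\<close> in the first \<open>r\<close> variables, choose
  a monomial \<open>u\<close> of the denominator and keep on both sides only the monomials that agree with \<open>u\<close> in
  the variables from \<open>r\<close> on. The common factor \<open>w\<close> in these variables then cancels.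
\<close>

lemma rational_rseq_iff: "rational_rseq r a \<longleftrightarrow> a \<in> rseqs r \<and> rational a"
proof
  assume "rational_rseq r a"
  then show "a \<in> rseqs r \<and> rational a" unfolding rational_rseq_def rational_def by blast
next
  assume "a \<in> rseqs r \<and> rational a"
  then obtain P Q where a: "a \<in> rseqs r"
    and Q: "Q \<noteq> 0" "series_mult (Poly_Mapping.lookup Q) a = Poly_Mapping.lookup P"
    unfolding rational_def by blast
  from Q(1) obtain u where u: "Poly_Mapping.lookup Q u \<noteq> 0"
    by (metis lookup_zero poly_mapping_eqI)
  have "finite {i. (if i < r then 0 else Poly_Mapping.lookup u i) \<noteq> 0}"
    by (rule finite_subset[OF _ finite_keys[of u]]) (auto simp: in_keys_iff split: if_splits)
  from finite_support_polynomial[OF this] obtain w :: mon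
    where w: "Poly_Mapping.lookup w = (\<lambda>i. if i < r then 0 else Poly_Mapping.lookup u i)" by blast
  define C where "C = {n. \<forall>i\<ge>r. Poly_Mapping.lookup n i = Poly_Mapping.lookup u i}"
  have C_iff: "n \<in> C \<longleftrightarrow> (\<exists>l\<in>tuples r. n = w + l)" for n
  proof
    assume n: "n \<in> C"
    have "n = w + (n - w)"
      using n by (intro poly_mapping_eqI) (auto simp: C_def w lookup_add lookup_minus)
    moreover have "n - w \<in> tuples r"
      using n by (auto simp: C_def w tuples_def lookup_minus in_keys_iff not_less[symmetric] split: if_splits)
    ultimately show "\<exists>l\<in>tuples r. n = w + l" by blast
  next
    assume "\<exists>l\<in>tuples r. n = w + l"
    then show "n \<in> C" by (force simp: C_def w tuples_def lookup_add in_keys_iff subset_iff)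
  qed
  have quotient: "\<exists>R'\<in>polys r. restrict_to C (Poly_Mapping.lookup R)
      = series_mult (Poly_Mapping.lookup (Poly_Mapping.single w 1)) (Poly_Mapping.lookup R')"
    for R :: "'a pol"
  proof -
    let ?f = "restrict_to C (Poly_Mapping.lookup R)"
    have "{l. ?f (w + l) \<noteq> 0} \<subseteq> (+) w -` Poly_Mapping.keys R"
      by (auto simp: restrict_to_def in_keys_iff)
    then have "finite {l. ?f (w + l) \<noteq> 0}"
      by (rule finite_subset) (auto intro!: finite_vimageI)
    from finite_support_polynomial[OF this] obtain R' where R': "Poly_Mapping.lookup R' = (\<lambda>l. ?f (w + l))"
      by blast
    have "R' \<in> polys r"
      by (auto simp: polys_def in_keys_iff R' restrict_to_def C_iff split: if_splits)
    moreover have "?f = series_mult (Poly_Mapping.lookup (Poly_Mapping.single w 1)) (Poly_Mapping.lookup R')"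
      unfolding R' by (rule factor_monomial) (auto simp: restrict_to_def C_iff split: if_splits)
    ultimately show ?thesis by blast
  qed
  obtain Q' where Q': "Q' \<in> polys r" "restrict_to C (Poly_Mapping.lookup Q)
      = series_mult (Poly_Mapping.lookup (Poly_Mapping.single w 1)) (Poly_Mapping.lookup Q')"
    using quotient by blast
  obtain P' where P': "P' \<in> polys r" "restrict_to C (Poly_Mapping.lookup P)
      = series_mult (Poly_Mapping.lookup (Poly_Mapping.single w 1)) (Poly_Mapping.lookup P')"
    using quotient by blast
  have "series_mult (restrict_to C (Poly_Mapping.lookup Q)) (restrict_to UNIV a)
      = restrict_to C (Poly_Mapping.lookup P)"
    unfolding Q(2)[symmetric]
  proof (rule series_mult_restrict_to)
    fix k l assume "a l \<noteq> 0"
    with a have "l \<in> tuples r" by (auto simp: rseqs_def)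
    then have "Poly_Mapping.lookup l i = 0" if "i \<ge> r" for i
      using that by (auto simp: tuples_def in_keys_iff subset_iff not_less[symmetric])
    then show "k + l \<in> C \<longleftrightarrow> k \<in> C \<and> l \<in> UNIV"
      by (auto simp: C_def lookup_add)
  qed
  also have "restrict_to UNIV a = a" by (simp add: restrict_to_def fun_eq_iff)
  finally have "series_mult (Poly_Mapping.lookup (Poly_Mapping.single w 1)) (series_mult (Poly_Mapping.lookup Q') a)
     = series_mult (Poly_Mapping.lookup (Poly_Mapping.single w 1)) (Poly_Mapping.lookup P')"
    unfolding Q' P' series_mult_assoc .
  then have "series_mult (Poly_Mapping.lookup Q') a n = Poly_Mapping.lookup P' n" for n
    using series_mult_single_add[of w 1 _ n] by (metis mult_1)
  then have "series_mult (Poly_Mapping.lookup Q') a = Poly_Mapping.lookup P'" by blast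
  moreover have "Q' \<noteq> 0"
  proof
    assume "Q' = 0"
    then have "restrict_to C (Poly_Mapping.lookup Q) u = 0"
      unfolding Q'(2) by (simp add: lookup_zero_fun)
    with u show False by (simp add: restrict_to_def C_def)
  qed
  ultimately show "rational_rseq r a" unfolding rational_rseq_def using a P'(1) Q'(1) by blast
qed

section \<open>Pointwise products with elements of shift-stable spaces\<close>

definition const_at :: "nat \<Rightarrow> (mon \<Rightarrow> 'k::field) \<Rightarrow> mon \<Rightarrow> 'k" where
  "const_at i f n = f (Poly_Mapping.update i 0 n)"

lemma module_hom_const_at: "module_hom seq_scale seq_scale (const_at i)"
  by unfold_locales (auto simp: const_at_def seq_scale_def fun_eq_iff)

lemma update_add_single_other:
  "j \<noteq> i \<Longrightarrow> Poly_Mapping.update i c (n + Poly_Mapping.single j e) = Poly_Mapping.update i c n + Poly_Mapping.single j e"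
  for n :: mon
  by (intro poly_mapping_eqI) (auto simp: lookup_update lookup_add lookup_single when_def)

lemma update_add_single_same:
  "Poly_Mapping.update i c (n + Poly_Mapping.single i e) = Poly_Mapping.update i c n"
  for n :: mon
  by (intro poly_mapping_eqI) (auto simp: lookup_update lookup_add lookup_single when_def)

lemma shift_const_at_same: "shift i (const_at i f) = const_at i f"
  by (auto simp: shift_def const_at_def update_add_single_same)

lemma shift_const_at_other: "j \<noteq> i \<Longrightarrow> shift j (const_at i f) = const_at i (shift j f)"
  by (auto simp: shift_def const_at_def update_add_single_other)

lemma shift_commute: "shift i (shift j f) = shift j (shift i f)"
  by (auto simp: shift_def add_ac)

text \<open>
  Passing to a proper subspace lowers the size of a suitable spanning set. The induction in
  \<open>hadamard_rational\<close> descends along this size, so that it can speak of finite sets only.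
\<close>

lemma smaller_spanning_set:
  assumes "finite B" "W \<subset> seq.span B" "seq.subspace W"
  shows "\<exists>B'. finite B' \<and> seq.span B' = W \<and> card B' < card B"
proof -
  obtain B' where B': "B' \<subseteq> W" "seq.independent B'" "W \<subseteq> seq.span B'"
    using seq.maximal_independent_subset by blast
  then have span: "seq.span B' = W" using assms(3) by (metis seq.span_subspace)
  obtain x where x: "x \<in> seq.span B" "x \<notin> W" using assms(2) by blast
  have "seq.independent (insert x B')" using B'(2) x(2) span by (intro seq.independent_insertI) auto
  moreover have "insert x B' \<subseteq> seq.span B" using x(1) B'(1) assms(2) by auto
  ultimately have "finite (insert x B') \<and> card (insert x B') \<le> card B"
    by (intro seq.independent_span_bound[OF assms(1)])
  moreover have "x \<notin> B'" using x(2) B'(1) by blast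
  ultimately show ?thesis using span by auto
qed

text \<open>
  The terms with \<open>n\<^sub>i = 0\<close> are collected in the first summand and the others in the second. In the
  first one, \<open>a\<close> may be replaced by its extension that is constant along direction \<open>i\<close>; the point
  is that the shift \<open>S\<^sub>i\<close> fixes this extension, whereas it would kill the slice of \<open>a\<close>.
\<close>

lemma hadamard_split:
  "a * b = const_at i a * restrict_to {n. Poly_Mapping.lookup n i = 0} b
     + series_mult (Poly_Mapping.lookup (Poly_Mapping.single (Poly_Mapping.single i 1) 1)) (shift i a * shift i b)"
  (is "_ = _ + ?t")
proof
  fix n :: mon
  let ?e = "Poly_Mapping.single i (1::nat)"
  show "(a * b) n = (const_at i a * restrict_to {n. Poly_Mapping.lookup n i = 0} b + ?t) n"
  proof (cases "Poly_Mapping.lookup n i = 0")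
    case True
    then have "Poly_Mapping.update i 0 n = n"
      by (intro poly_mapping_eqI) (auto simp: lookup_update)
    moreover have "?t n = 0"
      by (rule series_mult_single_eq_0) (use True in \<open>auto simp: lookup_add\<close>)
    ultimately show ?thesis using True by (simp add: const_at_def restrict_to_def)
  next
    case False
    then have n: "n = ?e + (n - ?e)"
      by (intro poly_mapping_eqI) (auto simp: lookup_add lookup_minus lookup_single when_def)
    have "?t n = (shift i a * shift i b) (n - ?e)"
      by (subst n) (simp only: series_mult_single_add mult_1)
    also have "\<dots> = a n * b n"
      using n by (simp add: shift_def add.commute)
    finally show ?thesis using False by (simp add: restrict_to_def)
  qed
qed

lemma rseqs_pointwise_mult: "b \<in> rseqs r \<Longrightarrow> v * b \<in> rseqs r"
  by (auto simp: rseqs_def)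

definition stuck_shifts :: "nat \<Rightarrow> (mon \<Rightarrow> 'k::field) set \<Rightarrow> nat set" where
  "stuck_shifts r V = {i. i < r \<and> shift i ` V \<noteq> V}"

text \<open>
  The surjectivity of the shifts is removed by induction on the number of shifts that are not
  surjective on the span \<open>V\<close> of \<open>B\<close>, and then on the size of \<open>B\<close>. If \<open>S\<^sub>i\<close> is not surjective on \<open>V\<close>,
  split the product as in \<open>hadamard_split\<close>. The first summand is handled by the space of constant extensions
  of \<open>V\<close>, on which \<open>S\<^sub>i\<close> has become the identity, and the second by \<open>S\<^sub>i V\<close>, a proper subspace of
  \<open>V\<close>. In both, every shift that was surjective remains so since it commutes with the construction.
\<close>

lemma hadamard_rational:
  fixes B :: "(mon \<Rightarrow> 'k::field) set"
  assumes "finite B" "\<And>i. i < r \<Longrightarrow> shift i ` seq.span B \<subseteq> seq.span B"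
    and "rational_rseq r b" and "a \<in> seq.span B"
  shows "rational (a * b)"
  using assms
proof (induction B arbitrary: a b
    rule: wf_induct_rule[OF wf_measures[of "[\<lambda>B. card (stuck_shifts r (seq.span B)), card]"]])
  case (1 B)
  note fin = \<open>finite B\<close> and inv = 1(3) and b = 1(4) and a = 1(5)
  let ?V = "seq.span B"
  have fin_stuck: "finite (stuck_shifts r V)" for V :: "(mon \<Rightarrow> 'k) set"
    by (simp add: stuck_shifts_def)
  show ?case
  proof (cases "stuck_shifts r ?V = {}")
    case True
    then show ?thesis
      using fin b a by (intro hadamard_rational_if_shifts_surjective) (auto simp: stuck_shifts_def)
  next
    case False
    then obtain i where i: "i < r" "shift i ` ?V \<noteq> ?V" by (auto simp: stuck_shifts_def)
    interpret sh: module_hom seq_scale seq_scale "shift i" by (rule module_hom_shift)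
    interpret ca: module_hom seq_scale seq_scale "const_at i" by (rule module_hom_const_at)
    have b': "b \<in> rseqs r" "rational b" using b by (auto simp: rational_rseq_iff)
    have "shift i ` ?V \<subset> ?V" using i inv[OF i(1)] by (simp add: psubset_eq)
    moreover have "seq.subspace (shift i ` ?V)" by (rule sh.subspace_image) (rule seq.subspace_span)
    ultimately have "\<exists>B1. finite B1 \<and> seq.span B1 = shift i ` ?V \<and> card B1 < card B"
      by (rule smaller_spanning_set[OF fin])
    then obtain B1 where B1: "finite B1" "seq.span B1 = shift i ` ?V" "card B1 < card B"
      by (elim exE conjE)
    have shift_B1: "shift j ` seq.span B1 = shift i ` shift j ` ?V" for j
      by (simp add: B1(2) image_image shift_commute[of j])
    have "rational (shift i a * shift i b)"
    proof (rule 1(1)[where y = B1])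
      have "shift j ` seq.span B1 = seq.span B1" if "shift j ` ?V = ?V" for j
        unfolding shift_B1 unfolding that B1(2) ..
      then have "stuck_shifts r (seq.span B1) \<subseteq> stuck_shifts r ?V"
        unfolding stuck_shifts_def by blast
      then have "card (stuck_shifts r (seq.span B1)) \<le> card (stuck_shifts r ?V)"
        by (intro card_mono fin_stuck)
      then show "(B1, B) \<in> measures [\<lambda>B. card (stuck_shifts r (seq.span B)), card]"
        using B1(3) by (auto simp: in_measures)
      show "shift j ` seq.span B1 \<subseteq> seq.span B1" if "j < r" for j
        unfolding shift_B1 unfolding B1(2) using inv[OF that] by (rule image_mono)
      have "shift i b \<in> rseqs r" using b'(1) by (auto simp: rseqs_def shift_def tuples_add_iff)
      then show "rational_rseq r (shift i b)" using rational_shift[OF b'(2)] by (auto simp: rational_rseq_iff)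
      show "shift i a \<in> seq.span B1" unfolding B1(2) using a by (rule imageI)
    qed (rule B1(1))
    moreover have "rational (const_at i a * restrict_to {n. Poly_Mapping.lookup n i = 0} b)"
    proof (rule 1(1)[where y = "const_at i ` B"])
      have span: "seq.span (const_at i ` B) = const_at i ` ?V" by (rule ca.span_image)
      have same: "shift i ` seq.span (const_at i ` B) = seq.span (const_at i ` B)"
        by (simp add: span image_image shift_const_at_same)
      have other: "shift j ` seq.span (const_at i ` B) = const_at i ` shift j ` ?V" if "j \<noteq> i" for j
        using that by (simp add: span image_image shift_const_at_other)
      have "shift j ` seq.span (const_at i ` B) = seq.span (const_at i ` B)" if "shift j ` ?V = ?V" for j
        using same other[of j] by (cases "j = i") (simp_all add: that flip: span)
      then have "stuck_shifts r (seq.span (const_at i ` B)) \<subseteq> stuck_shifts r ?V"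
        unfolding stuck_shifts_def by blast
      moreover have "i \<in> stuck_shifts r ?V" "i \<notin> stuck_shifts r (seq.span (const_at i ` B))"
        using i same by (auto simp: stuck_shifts_def)
      ultimately have "card (stuck_shifts r (seq.span (const_at i ` B))) < card (stuck_shifts r ?V)"
        by (intro psubset_card_mono fin_stuck) blast
      then show "(const_at i ` B, B) \<in> measures [\<lambda>B. card (stuck_shifts r (seq.span B)), card]"
        by (auto simp: in_measures)
      show "shift j ` seq.span (const_at i ` B) \<subseteq> seq.span (const_at i ` B)" if "j < r" for j
      proof (cases "j = i")
        case True
        show ?thesis unfolding True same ..
      next
        case False
        show ?thesis unfolding other[OF False] unfolding span using inv[OF that] by (rule image_mono)
      qed
      have "restrict_to {n. Poly_Mapping.lookup n i = 0} b \<in> rseqs r"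
        using b'(1) by (auto simp: rseqs_def restrict_to_def)
      then show "rational_rseq r (restrict_to {n. Poly_Mapping.lookup n i = 0} b)"
        using rational_slice[OF b'(2)] by (auto simp: rational_rseq_iff)
      show "const_at i a \<in> seq.span (const_at i ` B)" unfolding span using a by (rule imageI)
    qed (use fin in simp)
    ultimately show ?thesis
      by (subst hadamard_split[of _ _ i]) (intro rational_add rational_series_mult)
  qed
qed

section \<open>C-finite sequences and their products\<close>

lemma image_span_subset:
  assumes "module_hom seq_scale seq_scale f" "\<And>v. v \<in> B \<Longrightarrow> f v \<in> seq.span C"
  shows "f ` seq.span B \<subseteq> seq.span C"
proof -
  interpret f: module_hom seq_scale seq_scale f by fact
  have "seq.span (f ` B) \<subseteq> seq.span C"
    using assms(2) by (intro seq.span_minimal) auto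
  then show ?thesis by (simp add: f.span_image)
qed

text \<open>
  A C-finite sequence is one that lies in some finite-dimensional space stable under the shifts.
  In this form, C-finiteness is shown by exhibiting a space, which need not be the span of the
  shifts.
\<close>

lemma cfinite_rseq_iff:
  "cfinite_rseq r a \<longleftrightarrow> a \<in> rseqs r \<and>
     (\<exists>B. finite B \<and> a \<in> seq.span B \<and> (\<forall>i<r. \<forall>v\<in>B. shift i v \<in> seq.span B))"
proof
  let ?G = "{shifts r n a | n. n \<in> tuples r}"
  assume "cfinite_rseq r a"
  then obtain B where a: "a \<in> rseqs r" and B: "finite B" "seq.span ?G = seq.span B"
    unfolding cfinite_rseq_def by blast
  have zero: "0 \<in> tuples r" by (simp add: tuples_def)
  then have "a = shifts r 0 a" by (simp add: shifts_apply fun_eq_iff)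
  with zero have "a \<in> seq.span ?G" by (intro seq.span_base) blast
  moreover have "shift i v \<in> seq.span B" if "i < r" "v \<in> B" for i v
  proof -
    have "shift i ` seq.span ?G \<subseteq> seq.span ?G"
    proof (rule image_span_subset[OF module_hom_shift])
      fix w assume "w \<in> ?G"
      then obtain n where n: "n \<in> tuples r" "w = shifts r n a" by blast
      have "n + Poly_Mapping.single i 1 \<in> tuples r"
        using n(1) that(1) by (auto simp: tuples_add_iff) (simp add: tuples_def)
      moreover from this n have "shift i w = shifts r (n + Poly_Mapping.single i 1) a"
        by (auto simp: shift_def shifts_apply fun_eq_iff add_ac)
      ultimately show "shift i w \<in> seq.span ?G" by (intro seq.span_base) blast
    qed
    then show ?thesis using that(2) B(2) seq.span_base[of v B] by blast
  qed
  ultimately show "a \<in> rseqs r \<and> (\<exists>B. finite B \<and> a \<in> seq.span B \<and> (\<forall>i<r. \<forall>v\<in>B. shift i v \<in> seq.span B))"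
    using a B by auto
next
  let ?G = "{shifts r n a | n. n \<in> tuples r}"
  assume "a \<in> rseqs r \<and> (\<exists>B. finite B \<and> a \<in> seq.span B \<and> (\<forall>i<r. \<forall>v\<in>B. shift i v \<in> seq.span B))"
  then obtain B where a: "a \<in> rseqs r" and B: "finite B" "a \<in> seq.span B"
    and inv: "\<And>i v. i < r \<Longrightarrow> v \<in> B \<Longrightarrow> shift i v \<in> seq.span B" by blast
  have "shifts r n ` seq.span B \<subseteq> seq.span B" for n
    by (intro shifts_image_subset image_span_subset[OF module_hom_shift] inv)
  then have G: "?G \<subseteq> seq.span B" using B(2) by blast
  obtain B' where B': "B' \<subseteq> ?G" "seq.independent B'" "?G \<subseteq> seq.span B'"
    using seq.maximal_independent_subset by blast
  have "B' \<subseteq> seq.span B" using B'(1) G by (rule subset_trans)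
  then have "finite B'" using seq.independent_span_bound[OF B(1) B'(2)] by simp
  moreover have "seq.span ?G = seq.span B'"
    unfolding seq.span_eq using B'(1,3) seq.span_superset[of ?G] by (intro conjI) (assumption, rule subset_trans)
  ultimately show "cfinite_rseq r a" unfolding cfinite_rseq_def using a by (intro conjI exI)
qed

lemma cfinite_rseqI:
  assumes "a \<in> rseqs r" "finite B" "a \<in> seq.span B"
    and "\<And>i v. i < r \<Longrightarrow> v \<in> B \<Longrightarrow> shift i v \<in> seq.span B"
  shows "cfinite_rseq r a"
  unfolding cfinite_rseq_iff using assms by (intro conjI exI[of _ B]) simp_all

lemma cfinite_rseqE:
  assumes "cfinite_rseq r a"
  obtains B where "finite B" "a \<in> seq.span B" "\<And>i. i < r \<Longrightarrow> shift i ` seq.span B \<subseteq> seq.span B"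
proof -
  from assms obtain B where B: "finite B" "a \<in> seq.span B"
    and inv: "\<forall>i<r. \<forall>v\<in>B. shift i v \<in> seq.span B"
    unfolding cfinite_rseq_iff by (elim conjE exE)
  have "shift i ` seq.span B \<subseteq> seq.span B" if "i < r" for i
    using inv that by (intro image_span_subset[OF module_hom_shift]) simp
  with B show ?thesis by (rule that)
qed

lemma hadamard_cfinite_rational:
  assumes "cfinite_rseq r a" "rational_rseq r b"
  shows "rational_rseq r (a * b)"
proof -
  obtain B where B: "finite B" "a \<in> seq.span B" "\<And>i. i < r \<Longrightarrow> shift i ` seq.span B \<subseteq> seq.span B"
    by (rule cfinite_rseqE[OF assms(1)]) (rule that)
  have "rational (a * b)" by (rule hadamard_rational[OF B(1,3) assms(2) B(2)])
  then show ?thesis using assms(2) by (simp add: rational_rseq_iff rseqs_pointwise_mult)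
qed

lemma pointwise_mult_mem_span:
  assumes "v \<in> seq.span A" "w \<in> seq.span B"
  shows "v * w \<in> seq.span ((\<lambda>(x, y). x * y) ` (A \<times> B))"
proof -
  let ?C = "(\<lambda>(x, y). x * y) ` (A \<times> B)"
  have "(\<lambda>y. y * x) ` seq.span B \<subseteq> seq.span ?C" if "x \<in> A" for x
  proof (intro image_span_subset[OF module_hom_times] seq.span_base)
    fix y assume "y \<in> B"
    with that show "y * x \<in> ?C" by (intro image_eqI[of _ _ "(x, y)"]) (simp_all add: mult.commute)
  qed
  then have "w * x \<in> seq.span ?C" if "x \<in> A" for x
    using that assms(2) by (simp add: image_subset_iff)
  then have "x * w \<in> seq.span ?C" if "x \<in> A" for x
    using that by (simp only: mult.commute[of x w])
  then have "(\<lambda>x. x * w) ` seq.span A \<subseteq> seq.span ?C"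
    by (intro image_span_subset[OF module_hom_times])
  then show ?thesis using assms(1) by (simp add: image_subset_iff)
qed

lemma hadamard_cfinite:
  assumes "cfinite_rseq r a" "cfinite_rseq r b"
  shows "cfinite_rseq r (a * b)"
proof -
  obtain A where A: "finite A" "a \<in> seq.span A" "\<And>i. i < r \<Longrightarrow> shift i ` seq.span A \<subseteq> seq.span A"
    by (rule cfinite_rseqE[OF assms(1)]) (rule that)
  obtain B where B: "finite B" "b \<in> seq.span B" "\<And>i. i < r \<Longrightarrow> shift i ` seq.span B \<subseteq> seq.span B"
    by (rule cfinite_rseqE[OF assms(2)]) (rule that)
  let ?C = "(\<lambda>(x, y). x * y) ` (A \<times> B)"
  have inv_C: "shift i v \<in> seq.span ?C" if i: "i < r" and v: "v \<in> ?C" for i v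
  proof -
    obtain x y where v: "v = x * y" "x \<in> A" "y \<in> B" using v by auto
    have "shift i v = shift i x * shift i y" by (simp add: v(1) shift_def fun_eq_iff)
    moreover have "shift i x \<in> seq.span A" "shift i y \<in> seq.span B"
      using A(3)[OF i] B(3)[OF i] v seq.span_base[of x A] seq.span_base[of y B] by blast+
    ultimately show ?thesis using pointwise_mult_mem_span by simp
  qed
  show ?thesis
  proof (rule cfinite_rseqI[OF _ _ _ inv_C])
    show "a * b \<in> rseqs r" using assms(2) by (intro rseqs_pointwise_mult) (simp add: cfinite_rseq_def)
    show "finite ?C" using A(1) B(1) by simp
    show "a * b \<in> seq.span ?C" using A(2) B(2) by (rule pointwise_mult_mem_span)
  qed
qed

section \<open>Partial sums\<close>

text \<open>
  The sequence of partial sums in the first index has Hilbert series \<open>H / (1 - t\<^sub>1)\<close>.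
\<close>

definition partial_sums :: "(mon \<Rightarrow> 'k::field) \<Rightarrow> mon \<Rightarrow> 'k" where
  "partial_sums f n = (\<Sum>i = 0..Poly_Mapping.lookup n 0. f (Poly_Mapping.update 0 i n))"

lemma module_hom_partial_sums: "module_hom seq_scale seq_scale partial_sums"
  by unfold_locales (auto simp: partial_sums_def seq_scale_def fun_eq_iff sum.distrib sum_distrib_left)

lemma update_lookup_same: "Poly_Mapping.update i (Poly_Mapping.lookup n i) n = n"
  by (intro poly_mapping_eqI) (auto simp: lookup_update)

lemma shift_partial_sums_other: "j \<noteq> 0 \<Longrightarrow> shift j (partial_sums f) = partial_sums (shift j f)"
  by (auto simp: shift_def partial_sums_def fun_eq_iff lookup_add lookup_single update_add_single_other)

lemma shift_partial_sums_0: "shift 0 (partial_sums f) = partial_sums f + shift 0 f"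
proof
  fix n :: mon
  let ?n = "n + Poly_Mapping.single 0 1"
  have "Poly_Mapping.update 0 (Suc (Poly_Mapping.lookup n 0)) n = ?n"
    by (intro poly_mapping_eqI) (auto simp: lookup_update lookup_add lookup_single when_def)
  then show "shift 0 (partial_sums f) n = (partial_sums f + shift 0 f) n"
    by (simp add: shift_def partial_sums_def lookup_add update_add_single_same)
qed

lemma partial_sums_init:
  assumes "Poly_Mapping.lookup n 0 = 0"
  shows "partial_sums f n = f n"
  using update_lookup_same[of 0 n] assms by (simp add: partial_sums_def)

lemma rational_partial_sums:
  fixes f :: "mon \<Rightarrow> 'k::field"
  assumes "rational f"
  shows "rational (partial_sums f)"
proof -
  let ?e = "Poly_Mapping.single 0 1 :: mon"
  let ?t = "Poly_Mapping.single ?e (1 :: 'k)"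
  have "series_mult (Poly_Mapping.lookup (1 - ?t)) (partial_sums f) n = f n" for n
  proof -
    have "series_mult (Poly_Mapping.lookup (1 - ?t)) (partial_sums f) + series_mult (Poly_Mapping.lookup ?t) (partial_sums f)
        = series_mult (Poly_Mapping.lookup 1) (partial_sums f)"
      unfolding series_mult_add_left[symmetric] lookup_plus_fun[symmetric] by simp
    also have "\<dots> = partial_sums f"
      using series_mult_single_add[of 0 1 "partial_sums f"] by (auto simp: fun_eq_iff)
    finally have eq: "series_mult (Poly_Mapping.lookup (1 - ?t)) (partial_sums f) n
        = partial_sums f n - series_mult (Poly_Mapping.lookup ?t) (partial_sums f) n"
      by (simp only: eq_diff_eq flip: plus_fun_apply)
    show ?thesis
    proof (cases "Poly_Mapping.lookup n 0 = 0")
      case True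
      then have "series_mult (Poly_Mapping.lookup ?t) (partial_sums f) n = 0"
        by (intro series_mult_single_eq_0) (auto simp: lookup_add)
      with True show ?thesis unfolding eq by (simp add: partial_sums_init)
    next
      case False
      define l where "l = n - ?e"
      have n: "n = ?e + l"
        unfolding l_def using False
        by (intro poly_mapping_eqI) (auto simp: lookup_add lookup_minus lookup_single when_def)
      have "partial_sums f n = partial_sums f l + f n"
        using fun_cong[OF shift_partial_sums_0[of f], of l] by (simp add: shift_def n add.commute)
      then show ?thesis unfolding eq unfolding n series_mult_single_add by simp
    qed
  qed
  then have "series_mult (Poly_Mapping.lookup (1 - ?t)) (partial_sums f) = f" by blast
  moreover have "1 - ?t \<noteq> 0"
  proof (rule lookup_ne_0_imp_poly_ne_0)
    have "?e \<noteq> 0" by (metis lookup_single_eq lookup_zero zero_neq_one)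
    then show "Poly_Mapping.lookup (1 - ?t) 0 \<noteq> 0" by (simp add: lookup_minus lookup_single)
  qed
  ultimately show ?thesis using assms rational_cancel by metis
qed

lemma update_mem_tuples_iff:
  assumes "r \<ge> 1"
  shows "Poly_Mapping.update 0 c n \<in> tuples r \<longleftrightarrow> n \<in> tuples r"
  using assms by (auto simp: tuples_def keys_update)

text \<open>
  If a space \<open>V\<close> is stable under the shifts, then so is the sum of \<open>V\<close> and its image under
  \<^const>\<open>partial_sums\<close>: by \<open>shift_partial_sums_0\<close>, shifting a sequence of partial sums in the first index
  only adds an element of \<open>V\<close>.
\<close>

lemma cfinite_partial_sums:
  assumes "r \<ge> 1" "cfinite_rseq r a"
  shows "cfinite_rseq r (partial_sums a)"
proof -
  obtain B where B: "finite B" "a \<in> seq.span B" "\<And>i. i < r \<Longrightarrow> shift i ` seq.span B \<subseteq> seq.span B"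
    by (rule cfinite_rseqE[OF assms(2)]) (rule that)
  let ?C = "B \<union> partial_sums ` B"
  have sub1: "v \<in> seq.span ?C" if "v \<in> seq.span B" for v
    using that seq.span_mono[of B ?C] by (simp add: subsetD)
  have "partial_sums ` seq.span B \<subseteq> seq.span ?C"
    by (intro image_span_subset[OF module_hom_partial_sums] seq.span_base) simp
  then have sub2: "partial_sums v \<in> seq.span ?C" if "v \<in> seq.span B" for v
    using that by (simp add: image_subset_iff)
  have inv_C: "shift i v \<in> seq.span ?C" if i: "i < r" and v: "v \<in> ?C" for i v
  proof -
    have inv: "shift i w \<in> seq.span B" if "w \<in> B" for w
      using imageI[OF seq.span_base[OF that], of "shift i"] B(3)[OF i] by (rule subsetD[rotated])
    from v consider "v \<in> B" | w where "w \<in> B" "v = partial_sums w" by blast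
    then show ?thesis
    proof cases
      case 1
      show ?thesis by (rule sub1[OF inv[OF 1]])
    next
      case 2
      show ?thesis
      proof (cases "i = 0")
        case True
        have "partial_sums w \<in> seq.span ?C" "shift 0 w \<in> seq.span ?C"
          using sub1[OF inv[OF 2(1)]] sub2[OF seq.span_base[OF 2(1)]] unfolding True by simp_all
        then show ?thesis unfolding True 2(2) shift_partial_sums_0 by (rule seq.span_add)
      next
        case False
        show ?thesis unfolding 2(2) shift_partial_sums_other[OF False] by (rule sub2[OF inv[OF 2(1)]])
      qed
    qed
  qed
  show ?thesis
  proof (rule cfinite_rseqI[OF _ _ _ inv_C])
    have "a \<in> rseqs r" using assms(2) by (simp add: cfinite_rseq_def)
    then show "partial_sums a \<in> rseqs r"
      by (simp add: rseqs_def partial_sums_def update_mem_tuples_iff[OF assms(1)])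
    show "partial_sums a \<in> seq.span ?C" by (rule sub2[OF B(2)])
    show "finite ?C" using B(1) by simp
  qed
qed

section \<open>Arithmetic progressions in the first index\<close>

definition stretch :: "nat \<Rightarrow> mon \<Rightarrow> mon" where
  "stretch d n = Poly_Mapping.update 0 (d * Poly_Mapping.lookup n 0) n"

lemma lookup_stretch: "Poly_Mapping.lookup (stretch d n) i = (if i = 0 then d else 1) * Poly_Mapping.lookup n i"
  by (simp add: stretch_def lookup_update)

lemma stretch_add: "stretch d (k + l) = stretch d k + stretch d l"
  by (intro poly_mapping_eqI) (simp add: lookup_stretch lookup_add algebra_simps)

lemma stretch_single: "stretch d (Poly_Mapping.single i m) = Poly_Mapping.single i ((if i = 0 then d else 1) * m)"
  by (intro poly_mapping_eqI) (simp add: lookup_stretch lookup_single when_def)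

text \<open>
  Restricting the first index to multiples of \<open>d\<close> turns \<open>S\<^sub>1\<^sup>d\<close> into \<open>S\<^sub>1\<close>.
\<close>

lemma cfinite_stretch:
  assumes "r \<ge> 1" "d \<ge> 1" "cfinite_rseq r a"
  shows "cfinite_rseq r (\<lambda>n. a (stretch d n))"
proof -
  obtain B where B: "finite B" "a \<in> seq.span B" "\<And>i. i < r \<Longrightarrow> shift i ` seq.span B \<subseteq> seq.span B"
    by (rule cfinite_rseqE[OF assms(3)]) (rule that)
  let ?\<phi> = "\<lambda>(f :: mon \<Rightarrow> 'a) n. f (stretch d n)"
  interpret st: module_hom seq_scale seq_scale ?\<phi>
    by unfold_locales (auto simp: seq_scale_def fun_eq_iff)
  have inv_\<phi>: "shift i v \<in> seq.span (?\<phi> ` B)" if i: "i < r" and v: "v \<in> ?\<phi> ` B" for i v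
  proof -
    obtain w where w: "w \<in> B" "v = ?\<phi> w" using v by blast
    let ?m = "if i = 0 then d else 1"
    have "shift i v = ?\<phi> ((shift i ^^ ?m) w)"
      by (auto simp: w(2) shift_def funpow_shift stretch_add stretch_single fun_eq_iff)
    moreover have "(shift i ^^ ?m) ` seq.span B \<subseteq> seq.span B"
      by (rule funpow_image_subset[OF B(3)[OF i]])
    moreover have "w \<in> seq.span B" by (rule seq.span_base[OF w(1)])
    ultimately have "(shift i ^^ ?m) w \<in> seq.span B" by (simp add: image_subset_iff)
    then show ?thesis unfolding \<open>shift i v = _\<close> st.span_image by (rule imageI)
  qed
  show ?thesis
  proof (rule cfinite_rseqI[OF _ _ _ inv_\<phi>])
    have "a \<in> rseqs r" using assms(3) by (simp add: cfinite_rseq_def)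
    then show "?\<phi> a \<in> rseqs r"
      by (simp add: rseqs_def stretch_def update_mem_tuples_iff[OF assms(1)])
    show "?\<phi> a \<in> seq.span (?\<phi> ` B)" unfolding st.span_image using B(2) by (rule imageI)
    show "finite (?\<phi> ` B)" using B(1) by simp
  qed
qed

definition residue_indicator :: "nat \<Rightarrow> nat \<Rightarrow> mon \<Rightarrow> 'k::field" where
  "residue_indicator d j n = (if Poly_Mapping.lookup n 0 mod d = j then 1 else 0)"

text \<open>
  Replacing by 0 all terms whose first index is not a multiple of \<open>d\<close> is the pointwise product with
  a periodic, hence C-finite, sequence.
\<close>

lemma rational_residue_class:
  assumes "d \<ge> 1" "rational_rseq r a"
  shows "rational (residue_indicator d 0 * a)"
proof (rule hadamard_rational)
  let ?B = "residue_indicator d ` {..<d} :: (mon \<Rightarrow> 'a) set"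
  show "finite ?B" by simp
  show "rational_rseq r a" by fact
  show "residue_indicator d 0 \<in> seq.span ?B"
    using assms(1) by (intro seq.span_base) auto
  show "shift i ` seq.span ?B \<subseteq> seq.span ?B" for i
  proof (rule image_span_subset[OF module_hom_shift])
    fix v :: "mon \<Rightarrow> 'a" assume "v \<in> ?B"
    then obtain j where j: "j < d" "v = residue_indicator d j" by blast
    have "\<exists>j'<d. shift i v = residue_indicator d j'"
    proof (cases "i = 0")
      case False
      then have "shift i v = v" by (auto simp: j(2) shift_def residue_indicator_def lookup_add lookup_single fun_eq_iff)
      then show ?thesis using j by blast
    next
      case True
      show ?thesis
      proof (intro exI conjI)
        let ?j = "if j = 0 then d - 1 else j - 1"
        show "?j < d" using j(1) by auto
        have "Suc m mod d = j \<longleftrightarrow> m mod d = ?j" for m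
          using j(1) mod_less_divisor[of d m] unfolding mod_Suc by auto
        then show "shift i v = residue_indicator d ?j"
          unfolding j(2) True by (auto simp: shift_def residue_indicator_def lookup_add fun_eq_iff)
      qed
    qed
    then show "shift i v \<in> seq.span ?B" by (auto intro: seq.span_base)
  qed
qed

text \<open>
  If \<open>f\<close> is a series in \<open>t\<^sub>1\<^sup>d\<close>, the monomials of \<open>Q f\<close> whose exponent of \<open>t\<^sub>1\<close> is congruent to \<open>j\<close>
  modulo \<open>d\<close> come from those of \<open>Q\<close> with the same property. For a residue \<open>j\<close> that occurs in \<open>Q\<close>, this
  part of the equation \<open>Q f = P\<close> can be divided by \<open>t\<^sub>1\<^sup>j\<close> and rewritten in terms of \<open>t\<^sub>1\<^sup>d\<close>.
\<close>

lemma rational_stretch_if_supported_on_multiples: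
  fixes f :: "mon \<Rightarrow> 'k::field"
  assumes "d \<ge> 1" "rational f" and supp: "\<And>n. f n \<noteq> 0 \<Longrightarrow> d dvd Poly_Mapping.lookup n 0"
  shows "rational (\<lambda>n. f (stretch d n))"
proof -
  obtain P Q where Q: "Q \<noteq> 0" "series_mult (Poly_Mapping.lookup Q) f = Poly_Mapping.lookup P"
    using assms(2) unfolding rational_def by blast
  from Q(1) obtain u where u: "Poly_Mapping.lookup Q u \<noteq> 0"
    by (metis lookup_zero poly_mapping_eqI)
  define j where "j = Poly_Mapping.lookup u 0 mod d"
  have j: "j < d" using assms(1) by (simp add: j_def)
  define \<sigma> where "\<sigma> n = stretch d n + Poly_Mapping.single 0 j" for n
  define shrink where "shrink n = Poly_Mapping.update 0 (Poly_Mapping.lookup n 0 div d) n" for n :: mon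
  have lookup_shrink: "Poly_Mapping.lookup (shrink n) i = (if i = 0 then Poly_Mapping.lookup n i div d else Poly_Mapping.lookup n i)" for n i
    by (simp add: shrink_def lookup_update)
  have lookup_\<sigma>: "Poly_Mapping.lookup (\<sigma> n) i = (if i = 0 then d * Poly_Mapping.lookup n 0 + j else Poly_Mapping.lookup n i)" for n i
    by (simp add: \<sigma>_def lookup_add lookup_stretch lookup_single when_def)
  have shrink_\<sigma>: "shrink (\<sigma> n) = n" for n
    using j by (intro poly_mapping_eqI) (simp add: lookup_shrink lookup_\<sigma>)
  have shrink_stretch: "shrink (stretch d n) = n" for n
    using j by (intro poly_mapping_eqI) (simp add: lookup_shrink lookup_stretch)
  have \<sigma>_shrink: "\<sigma> (shrink n) = n" if "Poly_Mapping.lookup n 0 mod d = j" for n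
  proof -
    have "d * (Poly_Mapping.lookup n 0 div d) + j = Poly_Mapping.lookup n 0" unfolding that[symmetric] by simp
    then show ?thesis by (intro poly_mapping_eqI) (simp add: lookup_shrink lookup_\<sigma>)
  qed
  have stretch_shrink: "stretch d (shrink n) = n" if "d dvd Poly_Mapping.lookup n 0" for n
    using that by (intro poly_mapping_eqI) (simp add: lookup_shrink lookup_stretch)
  have \<sigma>_add: "\<sigma> k + stretch d l = \<sigma> (k + l)" for k l
    by (simp add: \<sigma>_def stretch_add add_ac)
  have fin: "finite {n. Poly_Mapping.lookup R (\<sigma> n) \<noteq> 0}" for R :: "'k pol"
  proof (rule finite_subset)
    show "{n. Poly_Mapping.lookup R (\<sigma> n) \<noteq> 0} \<subseteq> shrink ` Poly_Mapping.keys R"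
      by (force simp: in_keys_iff image_iff shrink_\<sigma>)
  qed simp
  obtain Q' P' where Q': "Poly_Mapping.lookup Q' = (\<lambda>n. Poly_Mapping.lookup Q (\<sigma> n))"
    and P': "Poly_Mapping.lookup P' = (\<lambda>n. Poly_Mapping.lookup P (\<sigma> n))"
    using finite_support_polynomial[OF fin] by metis
  have "series_mult (Poly_Mapping.lookup Q') (\<lambda>n. f (stretch d n)) n = series_mult (Poly_Mapping.lookup Q) f (\<sigma> n)" for n
    unfolding series_mult_def
  proof (rule sum.reindex_bij_witness_not_neutral[where
        S' = "{}" and T' = "{(k, l). k + l = \<sigma> n \<and> \<not> d dvd Poly_Mapping.lookup l 0}"
        and i = "\<lambda>(k, l). (shrink k, shrink l)" and j = "\<lambda>(k, l). (\<sigma> k, stretch d l)"])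
    show "finite {(k, l). k + l = \<sigma> n \<and> \<not> d dvd Poly_Mapping.lookup l 0}"
      by (rule finite_subset[OF _ finite_add_decomps[of "\<sigma> n"]]) auto
  next
    fix p assume p: "p \<in> {(k, l). k + l = \<sigma> n} - {(k, l). k + l = \<sigma> n \<and> \<not> d dvd Poly_Mapping.lookup l 0}"
    then obtain k l where kl: "p = (k, l)" "k + l = \<sigma> n" "d dvd Poly_Mapping.lookup l 0" by auto
    from kl(2) have "Poly_Mapping.lookup k 0 + Poly_Mapping.lookup l 0 = d * Poly_Mapping.lookup n 0 + j"
      using lookup_\<sigma>[of n 0] by (metis lookup_add)
    then have "(Poly_Mapping.lookup k 0 + Poly_Mapping.lookup l 0) mod d = j" using j by simp
    then have "Poly_Mapping.lookup k 0 mod d = j" using kl(3) by auto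
    then have eqs: "\<sigma> (shrink k) = k" "stretch d (shrink l) = l"
      using kl(3) by (simp_all add: \<sigma>_shrink stretch_shrink)
    then show "(case case p of (k, l) \<Rightarrow> (shrink k, shrink l) of (k, l) \<Rightarrow> (\<sigma> k, stretch d l)) = p"
      by (simp add: kl)
    have "\<sigma> (shrink k + shrink l) = \<sigma> n" using eqs kl(2) \<sigma>_add by metis
    then have "shrink k + shrink l = n" using shrink_\<sigma> by metis
    then show "(case p of (k, l) \<Rightarrow> (shrink k, shrink l)) \<in> {(k, l). k + l = n} - {}"
      by (simp add: kl)
  next
    fix p assume "p \<in> {(k, l). k + l = \<sigma> n \<and> \<not> d dvd Poly_Mapping.lookup l 0}"
    then show "(case p of (k, l) \<Rightarrow> Poly_Mapping.lookup Q k * f l) = 0" using supp by auto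
  qed (auto simp: shrink_\<sigma> shrink_stretch \<sigma>_add lookup_stretch Q')
  then have "series_mult (Poly_Mapping.lookup Q') (\<lambda>n. f (stretch d n)) = Poly_Mapping.lookup P'"
    unfolding Q(2) P' by blast
  moreover have "Poly_Mapping.lookup Q' (shrink u) \<noteq> 0"
    using u by (simp add: Q' \<sigma>_shrink j_def)
  then have "Q' \<noteq> 0" by (rule lookup_ne_0_imp_poly_ne_0)
  ultimately show ?thesis unfolding rational_def by blast
qed

lemma rational_stretch:
  assumes "r \<ge> 1" "d \<ge> 1" "rational_rseq r a"
  shows "rational_rseq r (\<lambda>n. a (stretch d n))"
proof -
  let ?f = "residue_indicator d 0 * a"
  have "rational (\<lambda>n. ?f (stretch d n))"
    by (rule rational_stretch_if_supported_on_multiples[OF assms(2) rational_residue_class[OF assms(2,3)]])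
       (auto simp: residue_indicator_def split: if_splits)
  moreover have "(\<lambda>n. ?f (stretch d n)) = (\<lambda>n. a (stretch d n))"
    by (auto simp: residue_indicator_def lookup_stretch)
  moreover have "(\<lambda>n. a (stretch d n)) \<in> rseqs r"
    using assms by (auto simp: rseqs_def rational_rseq_def stretch_def update_mem_tuples_iff)
  ultimately show ?thesis by (simp add: rational_rseq_iff)
qed

section \<open>Summation over one index\<close>

definition fibre_support :: "nat \<Rightarrow> (mon \<Rightarrow> 'k::field) \<Rightarrow> mon \<Rightarrow> nat set" where
  "fibre_support i f n = {m. f (n + Poly_Mapping.single i m) \<noteq> 0}"

text \<open>
  The series that may be evaluated at any value of \<open>t\<^sub>i\<close>: they are power series in the other
  variables with coefficients polynomial in \<open>t\<^sub>i\<close>.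
\<close>

definition fibre_finite :: "nat \<Rightarrow> (mon \<Rightarrow> 'k::field) \<Rightarrow> bool" where
  "fibre_finite i f \<longleftrightarrow> (\<forall>n. Poly_Mapping.lookup n i = 0 \<longrightarrow> finite (fibre_support i f n))"

text \<open>
  The coefficient of \<open>s\<^sup>k\<close> in the expansion of \<open>f\<close> around \<open>t\<^sub>i = 1\<close>, that is after substituting
  \<open>t\<^sub>i = 1 + s\<close>. For \<open>k = 0\<close> this is the sum along direction \<open>i\<close>. Binomial coefficients instead of
  derivatives make it meaningful in every characteristic.
\<close>

definition moment :: "nat \<Rightarrow> nat \<Rightarrow> (mon \<Rightarrow> 'k::field) \<Rightarrow> mon \<Rightarrow> 'k" where
  "moment i k f n = (if Poly_Mapping.lookup n i = 0
     then \<Sum>m\<in>fibre_support i f n. of_nat (m choose k) * f (n + Poly_Mapping.single i m) else 0)"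

lemma moment_eq_sum:
  assumes "Poly_Mapping.lookup n i = 0" "finite M" "fibre_support i f n \<subseteq> M"
  shows "moment i k f n = (\<Sum>m\<in>M. of_nat (m choose k) * f (n + Poly_Mapping.single i m))"
  unfolding moment_def using assms
  by (simp, intro sum.mono_neutral_left) (auto simp: fibre_support_def)

lemma
  assumes "fibre_finite i f" "fibre_finite i g"
  shows fibre_finite_add: "fibre_finite i (f + g)"
    and moment_add: "moment i k (f + g) = moment i k f + moment i k g"
proof -
  have sub: "fibre_support i (f + g) n \<subseteq> fibre_support i f n \<union> fibre_support i g n" for n
    by (auto simp: fibre_support_def)
  have fin: "finite (fibre_support i f n \<union> fibre_support i g n)" if "Poly_Mapping.lookup n i = 0" for n
    using assms that by (simp add: fibre_finite_def)
  show "fibre_finite i (f + g)"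
    unfolding fibre_finite_def using finite_subset[OF sub fin] by blast
  show "moment i k (f + g) = moment i k f + moment i k g"
  proof
    fix n
    show "moment i k (f + g) n = (moment i k f + moment i k g) n"
    proof (cases "Poly_Mapping.lookup n i = 0")
      case True
      note eq = moment_eq_sum[OF True fin[OF True]]
      show ?thesis
        unfolding plus_fun_apply[of "moment i k f"] eq[OF sub] eq[OF Un_upper1] eq[OF Un_upper2]
        by (simp add: sum.distrib algebra_simps)
    qed (simp add: moment_def)
  qed
qed

lemma moment_sum:
  assumes "\<And>j. j \<in> I \<Longrightarrow> fibre_finite i (f j)" "finite I"
  shows "moment i k (\<Sum>j\<in>I. f j) = (\<Sum>j\<in>I. moment i k (f j))"
proof -
  have "fibre_finite i (\<Sum>j\<in>I. f j) \<and> moment i k (\<Sum>j\<in>I. f j) = (\<Sum>j\<in>I. moment i k (f j))"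
    using assms(2,1)
  proof (induction I rule: finite_induct)
    case empty
    show ?case by (auto simp: fibre_finite_def fibre_support_def moment_def fun_eq_iff)
  next
    case (insert j I)
    then have "fibre_finite i (f j)" "fibre_finite i (sum f I)"
      "moment i k (sum f I) = (\<Sum>j\<in>I. moment i k (f j))" by simp_all
    then show ?case
      unfolding sum.insert[OF insert.hyps] using fibre_finite_add[of i "f j" "sum f I"] moment_add[of i "f j" "sum f I" k]
      by (simp only: simp_thms)
  qed
  then show ?thesis ..
qed

lemma monomial_split: "n = Poly_Mapping.update i 0 n + Poly_Mapping.single i (Poly_Mapping.lookup n i)" for n :: mon
  by (intro poly_mapping_eqI) (simp add: lookup_update lookup_add lookup_single when_def)

lemma add_single_cancel:
  fixes u v :: mon
  assumes "u + Poly_Mapping.single i a = v + Poly_Mapping.single i b"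
    and "Poly_Mapping.lookup u i = 0" "Poly_Mapping.lookup v i = 0"
  shows "u = v \<and> a = b"
proof -
  have *: "Poly_Mapping.lookup u j + (a when i = j) = Poly_Mapping.lookup v j + (b when i = j)" for j
    using arg_cong[OF assms(1), of "\<lambda>x. Poly_Mapping.lookup x j"] by (simp add: lookup_add lookup_single)
  have "u = v"
  proof (rule poly_mapping_eqI)
    show "Poly_Mapping.lookup u j = Poly_Mapping.lookup v j" for j
      using *[of j] assms(2,3) by (cases "i = j") auto
  qed
  moreover from this have "a = b" using *[of i] by (simp add: when_def)
  ultimately show ?thesis ..
qed

text \<open>
  The product rule for \<^const>\<open>moment\<close> when one factor is a monomial. It comes from the Vandermonde
  identity, and extends to all polynomials by linearity.
\<close>

lemma
  fixes f :: "mon \<Rightarrow> 'k::field"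
  assumes "fibre_finite i f"
  shows fibre_finite_single_mult: "fibre_finite i (series_mult (Poly_Mapping.lookup (Poly_Mapping.single v c)) f)"
    and moment_single_mult: "moment i k (series_mult (Poly_Mapping.lookup (Poly_Mapping.single v c)) f)
      = (\<Sum>j\<le>k. series_mult (Poly_Mapping.lookup (Poly_Mapping.single (Poly_Mapping.update i 0 v)
           (of_nat (Poly_Mapping.lookup v i choose j) * c))) (moment i (k - j) f))"
proof -
  let ?g = "series_mult (Poly_Mapping.lookup (Poly_Mapping.single v c)) f"
  define v0 where "v0 = Poly_Mapping.update i 0 v"
  define p where "p = Poly_Mapping.lookup v i"
  have v: "v = v0 + Poly_Mapping.single i p" unfolding v0_def p_def by (rule monomial_split)
  have v0: "Poly_Mapping.lookup v0 i = 0" by (simp add: v0_def lookup_update)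
  have g_nonzero: "\<exists>l. n = v0 + l \<and> m \<in> (\<lambda>m. m + p) ` fibre_support i f l"
    if n: "Poly_Mapping.lookup n i = 0" and nz: "?g (n + Poly_Mapping.single i m) \<noteq> 0" for n m
  proof -
    obtain l' where l': "n + Poly_Mapping.single i m = v + l'"
      using nz series_mult_single_eq_0 by blast
    define l where "l = Poly_Mapping.update i 0 l'"
    define q where "q = Poly_Mapping.lookup l' i"
    have l'_eq: "l' = l + Poly_Mapping.single i q" unfolding l_def q_def by (rule monomial_split)
    have l: "Poly_Mapping.lookup l i = 0" by (simp add: l_def lookup_update)
    have "n + Poly_Mapping.single i m = (v0 + l) + Poly_Mapping.single i (q + p)"
      unfolding l' v l'_eq single_add by (simp add: add_ac)
    then have "n = v0 + l \<and> m = q + p"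
      by (rule add_single_cancel) (simp_all add: n l v0 lookup_add)
    moreover have "q \<in> fibre_support i f l"
      using nz unfolding l' series_mult_single_add unfolding l'_eq by (simp add: fibre_support_def)
    ultimately show ?thesis by blast
  qed
  have g_shift: "?g (v0 + l + Poly_Mapping.single i (m + p)) = c * f (l + Poly_Mapping.single i m)" for l m
  proof -
    have "v0 + l + Poly_Mapping.single i (m + p) = v + (l + Poly_Mapping.single i m)"
      unfolding v single_add by (simp add: add_ac)
    then show ?thesis by (simp only: series_mult_single_add)
  qed
  have sub: "fibre_support i ?g (v0 + l) \<subseteq> (\<lambda>m. m + p) ` fibre_support i f l"
    if l: "Poly_Mapping.lookup l i = 0" for l
  proof
    fix m assume "m \<in> fibre_support i ?g (v0 + l)"
    then obtain l2 where "v0 + l = v0 + l2" "m \<in> (\<lambda>m. m + p) ` fibre_support i f l2"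
      using g_nonzero[of "v0 + l" m] l v0 by (auto simp: fibre_support_def lookup_add)
    then show "m \<in> (\<lambda>m. m + p) ` fibre_support i f l" by simp
  qed
  have empty: "fibre_support i ?g n = {}" if "Poly_Mapping.lookup n i = 0" "\<And>l. n \<noteq> v0 + l" for n
    using g_nonzero[OF that(1)] that(2) unfolding fibre_support_def by blast
  have fin: "finite (fibre_support i f l)" if "Poly_Mapping.lookup l i = 0" for l
    using assms that by (simp add: fibre_finite_def)
  show "fibre_finite i ?g"
    unfolding fibre_finite_def
  proof (intro allI impI)
    fix n :: mon assume n: "Poly_Mapping.lookup n i = 0"
    show "finite (fibre_support i ?g n)"
    proof (cases "\<exists>l. n = v0 + l")
      case True
      then obtain l where l: "n = v0 + l" by blast
      with n have "Poly_Mapping.lookup l i = 0" by (simp add: lookup_add)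
      then show ?thesis unfolding l using finite_subset[OF sub] fin by blast
    next
      case False
      then show ?thesis using empty[OF n] by simp
    qed
  qed
  show "moment i k ?g = (\<Sum>j\<le>k. series_mult (Poly_Mapping.lookup (Poly_Mapping.single (Poly_Mapping.update i 0 v)
           (of_nat (Poly_Mapping.lookup v i choose j) * c))) (moment i (k - j) f))"
    unfolding v0_def[symmetric] p_def[symmetric]
  proof
    fix n
    let ?r = "\<lambda>j. series_mult (Poly_Mapping.lookup (Poly_Mapping.single v0 (of_nat (p choose j) * c))) (moment i (k - j) f)"
    show "moment i k ?g n = (\<Sum>j\<le>k. ?r j) n"
    proof (cases "\<exists>l. n = v0 + l")
      case False
      then have "(\<Sum>j\<le>k. ?r j) n = 0"
        unfolding sum_apply by (intro sum.neutral ballI series_mult_single_eq_0) blast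
      moreover have "moment i k ?g n = 0"
        using empty[of n] False by (auto simp: moment_def)
      ultimately show ?thesis by simp
    next
      case True
      then obtain l where l: "n = v0 + l" by blast
      have rhs: "(\<Sum>j\<le>k. ?r j) n = (\<Sum>j\<le>k. of_nat (p choose j) * c * moment i (k - j) f l)"
        unfolding sum_apply l series_mult_single_add ..
      show ?thesis
      proof (cases "Poly_Mapping.lookup l i = 0")
        case False
        then show ?thesis unfolding rhs by (simp add: moment_def l lookup_add)
      next
        case True
        let ?F = "fibre_support i f l"
        have "moment i k ?g n = (\<Sum>m\<in>(\<lambda>m. m + p) ` ?F. of_nat (m choose k) * ?g (n + Poly_Mapping.single i m))"
          unfolding l by (rule moment_eq_sum) (use True v0 sub[OF True] fin[OF True] in \<open>simp_all add: lookup_add\<close>)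
        also have "\<dots> = (\<Sum>m\<in>?F. of_nat ((p + m) choose k) * (c * f (l + Poly_Mapping.single i m)))"
          unfolding l by (subst sum.reindex) (simp_all only: o_def g_shift inj_on_def add_right_cancel add.commute[of p], simp_all)
        also have "\<dots> = (\<Sum>m\<in>?F. \<Sum>j\<le>k. of_nat (p choose j) * c * (of_nat (m choose (k - j)) * f (l + Poly_Mapping.single i m)))"
          unfolding vandermonde[symmetric] by (simp add: sum_distrib_left sum_distrib_right algebra_simps)
        also have "\<dots> = (\<Sum>j\<le>k. \<Sum>m\<in>?F. of_nat (p choose j) * c * (of_nat (m choose (k - j)) * f (l + Poly_Mapping.single i m)))"
          by (rule sum.swap)
        also have "\<dots> = (\<Sum>j\<le>k. ?r j) n"
          unfolding rhs by (simp add: moment_def True sum_distrib_left)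
        finally show ?thesis .
      qed
    qed
  qed
qed

text \<open>
  The coefficient of \<open>s\<^sup>j\<close> in \<open>Q\<close> after substituting \<open>t\<^sub>i = 1 + s\<close>, written out monomial by monomial.
\<close>

definition poly_moment :: "nat \<Rightarrow> nat \<Rightarrow> 'k::field pol \<Rightarrow> 'k pol" where
  "poly_moment i j Q = (\<Sum>v\<in>Poly_Mapping.keys Q.
     Poly_Mapping.single (Poly_Mapping.update i 0 v) (of_nat (Poly_Mapping.lookup v i choose j) * Poly_Mapping.lookup Q v))"

lemma moment_series_mult:
  assumes "fibre_finite i f"
  shows "moment i k (series_mult (Poly_Mapping.lookup Q) f)
     = (\<Sum>j\<le>k. series_mult (Poly_Mapping.lookup (poly_moment i j Q)) (moment i (k - j) f))"
proof -
  have "moment i k (series_mult (Poly_Mapping.lookup Q) f)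
     = (\<Sum>v\<in>Poly_Mapping.keys Q. moment i k (series_mult (Poly_Mapping.lookup (Poly_Mapping.single v (Poly_Mapping.lookup Q v))) f))"
    unfolding series_mult_monomials[of Q] by (intro moment_sum fibre_finite_single_mult assms finite_keys)
  also have "\<dots> = (\<Sum>v\<in>Poly_Mapping.keys Q. \<Sum>j\<le>k. series_mult (Poly_Mapping.lookup (Poly_Mapping.single (Poly_Mapping.update i 0 v)
           (of_nat (Poly_Mapping.lookup v i choose j) * Poly_Mapping.lookup Q v))) (moment i (k - j) f))"
    unfolding moment_single_mult[OF assms] ..
  also have "\<dots> = (\<Sum>j\<le>k. \<Sum>v\<in>Poly_Mapping.keys Q. series_mult (Poly_Mapping.lookup (Poly_Mapping.single (Poly_Mapping.update i 0 v)
           (of_nat (Poly_Mapping.lookup v i choose j) * Poly_Mapping.lookup Q v))) (moment i (k - j) f))"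
    by (rule sum.swap)
  also have "\<dots> = (\<Sum>j\<le>k. series_mult (Poly_Mapping.lookup (poly_moment i j Q)) (moment i (k - j) f))"
    unfolding poly_moment_def lookup_sum_fun series_mult_sum_left ..
  finally show ?thesis .
qed

text \<open>
  With \<open>e\<close> the degree of \<open>Q\<close> in \<open>t\<^sub>i\<close>, the coefficient of \<open>s\<^sup>e\<close> in \<open>Q\<close> at \<open>t\<^sub>i = 1 + s\<close> is the leading
  coefficient of \<open>Q\<close> as a polynomial in \<open>t\<^sub>i\<close>.
\<close>

lemma poly_moment_nonzero:
  assumes "Q \<noteq> 0"
  shows "\<exists>j. poly_moment i j Q \<noteq> 0"
proof -
  let ?d = "\<lambda>v. Poly_Mapping.lookup v i"
  define e where "e = Max (?d ` Poly_Mapping.keys Q)"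
  have "e \<in> ?d ` Poly_Mapping.keys Q"
    unfolding e_def using assms by (intro Max_in) auto
  then obtain u where u: "u \<in> Poly_Mapping.keys Q" "?d u = e" by blast
  have e_max: "?d v \<le> e" if "v \<in> Poly_Mapping.keys Q" for v
    unfolding e_def using that by (intro Max_ge) auto
  have "Poly_Mapping.lookup (poly_moment i e Q) (Poly_Mapping.update i 0 u)
      = (\<Sum>v\<in>Poly_Mapping.keys Q. if v = u then Poly_Mapping.lookup Q v else 0)"
    unfolding poly_moment_def lookup_sum
  proof (rule sum.cong[OF refl])
    fix v assume v: "v \<in> Poly_Mapping.keys Q"
    show "Poly_Mapping.lookup (Poly_Mapping.single (Poly_Mapping.update i 0 v) (of_nat (?d v choose e) * Poly_Mapping.lookup Q v))
            (Poly_Mapping.update i 0 u) = (if v = u then Poly_Mapping.lookup Q v else 0)"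
    proof (cases "v = u")
      case True
      then show ?thesis by (simp add: u(2))
    next
      case False
      show ?thesis
      proof (cases "?d v = e")
        case True
        then have "Poly_Mapping.update i 0 v \<noteq> Poly_Mapping.update i 0 u"
          using False u(2) monomial_split[of v i] monomial_split[of u i] by metis
        then show ?thesis using False by (simp add: lookup_single when_def)
      next
        case False
        then have "?d v choose e = 0" using e_max[OF v] by (intro binomial_eq_0) simp
        then show ?thesis using \<open>v \<noteq> u\<close> by (simp only: of_nat_0 mult_zero_left single_zero lookup_zero if_False)
      qed
    qed
  qed
  also have "\<dots> = Poly_Mapping.lookup Q u" using u(1) by simp
  finally have "Poly_Mapping.lookup (poly_moment i e Q) (Poly_Mapping.update i 0 u) \<noteq> 0"
    using u(1) by (simp add: in_keys_iff)
  then have "poly_moment i e Q \<noteq> 0" by (rule lookup_ne_0_imp_poly_ne_0)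
  then show ?thesis ..
qed

lemma rational_moment_lookup: "rational (moment i k (Poly_Mapping.lookup P))"
proof -
  have "{n. moment i k (Poly_Mapping.lookup P) n \<noteq> 0} \<subseteq> Poly_Mapping.update i 0 ` Poly_Mapping.keys P"
  proof
    fix n assume "n \<in> {n. moment i k (Poly_Mapping.lookup P) n \<noteq> 0}"
    then have n: "Poly_Mapping.lookup n i = 0" and "fibre_support i (Poly_Mapping.lookup P) n \<noteq> {}"
      by (auto simp: moment_def split: if_splits)
    then obtain m where "n + Poly_Mapping.single i m \<in> Poly_Mapping.keys P"
      by (auto simp: fibre_support_def in_keys_iff)
    moreover have "n = Poly_Mapping.update i 0 (n + Poly_Mapping.single i m)"
      unfolding update_add_single_same using update_lookup_same[of i n] n by simp
    ultimately show "n \<in> Poly_Mapping.update i 0 ` Poly_Mapping.keys P" by (rule rev_image_eqI)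
  qed
  then have "finite {n. moment i k (Poly_Mapping.lookup P) n \<noteq> 0}"
    by (rule finite_subset) simp
  from finite_support_polynomial[OF this] show ?thesis using rational_lookup by metis
qed

text \<open>
  Setting \<open>t\<^sub>i = 1\<close> in \<open>Q f = P\<close> would give the claim, but \<open>Q\<close> may vanish there. With \<open>t\<^sub>i = 1 + s\<close> and \<open>e\<close>
  the order of vanishing of \<open>Q\<close> at \<open>s = 0\<close>, one compares the coefficients of \<open>s\<^sup>e\<close> instead, where only the
  value of \<open>f\<close> at \<open>t\<^sub>i = 1\<close> is involved.
\<close>

lemma rational_moment_0:
  assumes "rational f" "fibre_finite i f"
  shows "rational (moment i 0 f)"
proof -
  obtain P Q where Q: "Q \<noteq> 0" "series_mult (Poly_Mapping.lookup Q) f = Poly_Mapping.lookup P"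
    using assms(1) unfolding rational_def by blast
  define e where "e = (LEAST j. poly_moment i j Q \<noteq> 0)"
  have e: "poly_moment i e Q \<noteq> 0"
    unfolding e_def using poly_moment_nonzero[OF Q(1)] by (rule LeastI_ex)
  have below: "poly_moment i j Q = 0" if "j < e" for j
    using not_less_Least[OF that[unfolded e_def]] by simp
  have "moment i e (Poly_Mapping.lookup P)
      = (\<Sum>j\<le>e. series_mult (Poly_Mapping.lookup (poly_moment i j Q)) (moment i (e - j) f))"
    unfolding Q(2)[symmetric] by (rule moment_series_mult[OF assms(2)])
  also have "\<dots> = (\<Sum>j\<in>{e}. series_mult (Poly_Mapping.lookup (poly_moment i j Q)) (moment i (e - j) f))"
  proof (rule sum.mono_neutral_right)
    show "\<forall>j\<in>{..e} - {e}. series_mult (Poly_Mapping.lookup (poly_moment i j Q)) (moment i (e - j) f) = 0"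
    proof
      fix j assume "j \<in> {..e} - {e}"
      then have "poly_moment i j Q = 0" by (intro below) auto
      then show "series_mult (Poly_Mapping.lookup (poly_moment i j Q)) (moment i (e - j) f) = 0"
        by (simp only: lookup_zero_fun series_mult_zero_left)
    qed
  qed simp_all
  also have "\<dots> = series_mult (Poly_Mapping.lookup (poly_moment i e Q)) (moment i 0 f)" by simp
  finally have "rational (series_mult (Poly_Mapping.lookup (poly_moment i e Q)) (moment i 0 f))"
    using rational_moment_lookup by metis
  then show ?thesis using e by (rule rational_cancel)
qed

section \<open>Contraction with a rational sequence\<close>

lemma series_mult_single_var:
  "series_mult f g (Poly_Mapping.single i M)
     = (\<Sum>m\<le>M. f (Poly_Mapping.single i m) * g (Poly_Mapping.single i (M - m)))"
proof -
  have eq: "k = Poly_Mapping.single i (Poly_Mapping.lookup k i)" "l = Poly_Mapping.single i (M - Poly_Mapping.lookup k i)"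
    "Poly_Mapping.lookup k i \<le> M" if "k + l = Poly_Mapping.single i M" for k l :: mon
  proof -
    have *: "Poly_Mapping.lookup k j + Poly_Mapping.lookup l j = (M when i = j)" for j
      using arg_cong[OF that, of "\<lambda>x. Poly_Mapping.lookup x j"] by (simp add: lookup_add lookup_single)
    show "k = Poly_Mapping.single i (Poly_Mapping.lookup k i)"
    proof (rule poly_mapping_eqI)
      show "Poly_Mapping.lookup k j = Poly_Mapping.lookup (Poly_Mapping.single i (Poly_Mapping.lookup k i)) j" for j
        using *[of j] by (cases "i = j") (auto simp: lookup_single)
    qed
    show "l = Poly_Mapping.single i (M - Poly_Mapping.lookup k i)"
    proof (rule poly_mapping_eqI)
      show "Poly_Mapping.lookup l j = Poly_Mapping.lookup (Poly_Mapping.single i (M - Poly_Mapping.lookup k i)) j" for j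
        using *[of j] by (cases "i = j") (auto simp: lookup_single)
    qed
    show "Poly_Mapping.lookup k i \<le> M" using *[of i] by simp
  qed
  show ?thesis
    unfolding series_mult_def
  proof (rule sum.reindex_bij_witness[of _ "\<lambda>m. (Poly_Mapping.single i m, Poly_Mapping.single i (M - m))"
        "\<lambda>(k, l). Poly_Mapping.lookup k i"])
    fix p assume "p \<in> {(k, l). k + l = Poly_Mapping.single i M}"
    then obtain k l where p: "p = (k, l)" and kl: "k + l = Poly_Mapping.single i M" by blast
    note e = eq(1,2)[OF kl, symmetric]
    show "(Poly_Mapping.single i (case p of (k, l) \<Rightarrow> Poly_Mapping.lookup k i),
        Poly_Mapping.single i (M - (case p of (k, l) \<Rightarrow> Poly_Mapping.lookup k i))) = p"
      by (simp add: p e)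
    show "(case p of (k, l) \<Rightarrow> Poly_Mapping.lookup k i) \<in> {..M}"
      using eq(3)[OF kl] by (simp add: p)
    show "f (Poly_Mapping.single i (case p of (k, l) \<Rightarrow> Poly_Mapping.lookup k i)) *
        g (Poly_Mapping.single i (M - (case p of (k, l) \<Rightarrow> Poly_Mapping.lookup k i)))
        = (case p of (k, l) \<Rightarrow> f k * g l)"
      by (simp add: p e)
  qed (auto simp flip: single_add)
qed

lemma tuples_1_iff: "n \<in> tuples 1 \<longleftrightarrow> n = Poly_Mapping.single 0 (Poly_Mapping.lookup n 0)"
proof
  assume n: "n \<in> tuples 1"
  show "n = Poly_Mapping.single 0 (Poly_Mapping.lookup n 0)"
  proof (rule poly_mapping_eqI)
    fix j
    have "Poly_Mapping.lookup n j = 0" if "j \<noteq> 0"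
      using n that by (auto simp: tuples_def in_keys_iff subset_iff)
    then show "Poly_Mapping.lookup n j = Poly_Mapping.lookup (Poly_Mapping.single 0 (Poly_Mapping.lookup n 0)) j"
      by (cases "j = 0") (simp_all add: lookup_single)
  qed
next
  assume "n = Poly_Mapping.single 0 (Poly_Mapping.lookup n 0)"
  then have "Poly_Mapping.keys n \<subseteq> {0}" using keys_single[of 0 "Poly_Mapping.lookup n 0"] by (metis empty_subsetI order_refl)
  then show "n \<in> tuples 1" by (auto simp: tuples_def)
qed

text \<open>
  In one variable, rational sequences satisfy a linear recurrence without exceptional initial
  terms: this is the coefficient of \<open>t\<^sup>N\<^sup>+\<^sup>J\<^sup>+\<^sup>e\<close> in \<open>Q b = P\<close>, solved for the term that comes with the
  lowest coefficient \<open>Q\<^sub>e\<close> of \<open>Q\<close>.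
\<close>

lemma rational_sequence_recurrence:
  assumes "rational_rseq 1 b"
  shows "\<exists>J>0. \<exists>c. \<forall>N. b (Poly_Mapping.single 0 (N + J)) = (\<Sum>j<J. c j * b (Poly_Mapping.single 0 (N + j)))"
proof -
  obtain P Q where Q: "Q \<in> polys 1" "Q \<noteq> 0" "series_mult (Poly_Mapping.lookup Q) b = Poly_Mapping.lookup P"
    using assms unfolding rational_rseq_def by blast
  define q where "q m = Poly_Mapping.lookup Q (Poly_Mapping.single 0 m)" for m
  define p where "p m = Poly_Mapping.lookup P (Poly_Mapping.single 0 m)" for m
  define \<beta> where "\<beta> m = b (Poly_Mapping.single 0 m)" for m
  have fin: "finite {m. Poly_Mapping.lookup R (Poly_Mapping.single 0 m) \<noteq> 0}" for R :: "'a pol"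
    by (rule finite_subset[of _ "(\<lambda>k. Poly_Mapping.lookup k 0) ` Poly_Mapping.keys R"])
       (force simp: in_keys_iff image_iff)+
  obtain u where u: "Poly_Mapping.lookup Q u \<noteq> 0" using Q(2) by (metis lookup_zero poly_mapping_eqI)
  then have "u \<in> tuples 1" using Q(1) by (auto simp: polys_def in_keys_iff)
  then have "q (Poly_Mapping.lookup u 0) \<noteq> 0" using u tuples_1_iff[of u] by (simp add: q_def)
  then have ex: "\<exists>m. q m \<noteq> 0" by blast
  define e where "e = (LEAST m. q m \<noteq> 0)"
  have qe: "q e \<noteq> 0" unfolding e_def using ex by (rule LeastI_ex)
  have q_below: "q m = 0" if "m < e" for m using not_less_Least[OF that[unfolded e_def]] by simp
  have bounded: "\<exists>D. \<forall>m\<ge>D. f m = 0" if "finite {m. f m \<noteq> 0}" for f :: "nat \<Rightarrow> 'a"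
  proof -
    from that obtain D where "\<forall>m\<in>{m. f m \<noteq> 0}. m < D"
      unfolding finite_nat_set_iff_bounded by blast
    then have "f m = 0" if "D \<le> m" for m using that by (meson leD mem_Collect_eq)
    then show ?thesis by blast
  qed
  obtain D where D: "\<And>m. m \<ge> D \<Longrightarrow> q m = 0"
    using bounded[of q] fin[of Q] unfolding q_def by blast
  obtain D' where D': "\<And>m. m \<ge> D' \<Longrightarrow> p m = 0"
    using bounded[of p] fin[of P] unfolding p_def by blast
  \<comment> \<open>Larger than the degree of \<open>P\<close>, so that \<open>P\<close> does not contribute, and than that of \<open>Q\<close>, so that the terms of \<open>b\<close> before \<open>N\<close> do not either. The successor ensures \<open>J > 0\<close>.\<close>
  define J where "J = Suc (max D D')"
  define c where "c j = - q (J + e - j) / q e" for j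
  have rec: "\<beta> (N + J) = (\<Sum>j<J. c j * \<beta> (N + j))" for N
  proof -
    have "0 = p (N + J + e)" by (rule D'[symmetric]) (simp add: J_def)
    also have "\<dots> = (\<Sum>m\<le>N + J + e. q m * \<beta> (N + J + e - m))"
      unfolding p_def q_def \<beta>_def Q(3)[symmetric] by (rule series_mult_single_var)
    also have "\<dots> = (\<Sum>m\<in>{e..J + e}. q m * \<beta> (N + J + e - m))"
    proof (rule sum.mono_neutral_right)
      show "\<forall>m\<in>{..N + J + e} - {e..J + e}. q m * \<beta> (N + J + e - m) = 0"
      proof
        fix m assume "m \<in> {..N + J + e} - {e..J + e}"
        then have "m < e \<or> D \<le> m" by (auto simp: J_def)
        then show "q m * \<beta> (N + J + e - m) = 0" using q_below D by auto
      qed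
    qed auto
    also have "{e..J + e} = insert e {e<..J + e}" by auto
    also have "(\<Sum>m\<in>insert e {e<..J + e}. q m * \<beta> (N + J + e - m))
        = q e * \<beta> (N + J) + (\<Sum>m\<in>{e<..J + e}. q m * \<beta> (N + J + e - m))"
      by simp
    also have "(\<Sum>m\<in>{e<..J + e}. q m * \<beta> (N + J + e - m)) = (\<Sum>j<J. q (J + e - j) * \<beta> (N + j))"
      by (rule sum.reindex_bij_witness[of _ "\<lambda>j. J + e - j" "\<lambda>m. J + e - m"])
         (auto simp: add.assoc)
    finally have "q e * \<beta> (N + J) = - (\<Sum>j<J. q (J + e - j) * \<beta> (N + j))"
      by (simp add: eq_neg_iff_add_eq_0)
    then have "\<beta> (N + J) = - (\<Sum>j<J. q (J + e - j) * \<beta> (N + j)) / q e"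
      using qe by (simp add: field_simps)
    then show ?thesis
      by (simp add: c_def sum_divide_distrib sum_negf)
  qed
  have "J > 0" by (simp add: J_def)
  then show ?thesis using rec unfolding \<beta>_def by blast
qed

text \<open>
  Viewed as a sequence in two indices that does not depend on the first, \<open>b\<close> is fixed by \<open>S\<^sub>1\<close>, and its
  translates under \<open>S\<^sub>2\<close> span a finite-dimensional space because of the recurrence.
\<close>

lemma rational_mult_second_index:
  fixes a b :: "mon \<Rightarrow> 'k::field"
  assumes "rational_rseq 2 a" "rational_rseq 1 b"
  shows "rational (\<lambda>n. a n * b (Poly_Mapping.single 0 (Poly_Mapping.lookup n 1)))"
proof -
  obtain J c where J: "J > 0"
    and rec: "\<And>N. b (Poly_Mapping.single 0 (N + J)) = (\<Sum>j<J. c j * b (Poly_Mapping.single 0 (N + j)))"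
    using rational_sequence_recurrence[OF assms(2)] by blast
  define \<beta> where "\<beta> j = (\<lambda>n :: mon. b (Poly_Mapping.single 0 (Poly_Mapping.lookup n 1 + j)))" for j
  let ?B = "\<beta> ` {..<J}"
  have base: "\<beta> j \<in> seq.span ?B" if "j < J" for j using that by (intro seq.span_base) simp
  have "rational (\<beta> 0 * a)"
  proof (rule hadamard_rational[OF _ _ assms(1)])
    show "\<beta> 0 \<in> seq.span ?B" using J by (rule base)
    fix i :: nat assume i: "i < 2"
    show "shift i ` seq.span ?B \<subseteq> seq.span ?B"
    proof (rule image_span_subset[OF module_hom_shift])
      fix v assume "v \<in> ?B"
      then obtain j where j: "j < J" "v = \<beta> j" by blast
      show "shift i v \<in> seq.span ?B"
      proof (cases "i = 1")
        case False
        then have "shift i v = v"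
          by (auto simp: j(2) \<beta>_def shift_def lookup_add lookup_single fun_eq_iff)
        then show ?thesis using base[OF j(1)] j(2) by simp
      next
        case True
        then have shift_v: "shift i v = \<beta> (Suc j)"
          by (auto simp: j(2) \<beta>_def shift_def lookup_add fun_eq_iff)
        show ?thesis
        proof (cases "Suc j = J")
          case True
          have "\<beta> J = (\<Sum>j<J. seq_scale (c j) (\<beta> j))"
            by (auto simp: \<beta>_def rec seq_scale_def sum_apply fun_eq_iff)
          then show ?thesis unfolding shift_v True
            using base by (auto intro!: seq.span_sum seq.span_scale)
        next
          case False
          then show ?thesis unfolding shift_v using j(1) by (intro base) simp
        qed
      qed
    qed
  qed simp
  then show ?thesis by (simp add: \<beta>_def times_eq_lambda mult.commute)
qed

lemma update_eq_add_single:
  "Poly_Mapping.lookup n i = 0 \<Longrightarrow> Poly_Mapping.update i m n = n + Poly_Mapping.single i m" for n :: mon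
  by (intro poly_mapping_eqI) (auto simp: lookup_update lookup_add lookup_single when_def)

lemma rational_sum_over_last:
  fixes a a' :: "mon \<Rightarrow> 'k::field"
  assumes "rational_rseq (Suc r) a"
    and fin: "\<And>n. n \<in> tuples r \<Longrightarrow> finite {m. a (Poly_Mapping.update r m n) \<noteq> 0}"
    and a': "a' \<in> rseqs r"
      "\<And>n. n \<in> tuples r \<Longrightarrow> a' n = (\<Sum>m\<in>{m. a (Poly_Mapping.update r m n) \<noteq> 0}. a (Poly_Mapping.update r m n))"
  shows "rational_rseq r a'"
proof -
  have a: "a \<in> rseqs (Suc r)" "rational a" using assms(1) by (auto simp: rational_rseq_iff)
  have tuples_iff: "n \<in> tuples r \<longleftrightarrow> n \<in> tuples (Suc r) \<and> Poly_Mapping.lookup n r = 0" for n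
    by (auto simp: tuples_def in_keys_iff subset_iff less_Suc_eq) (metis less_irrefl)
  have supp: "fibre_support r a n = (if n \<in> tuples (Suc r) then {m. a (Poly_Mapping.update r m n) \<noteq> 0} else {})"
    if "Poly_Mapping.lookup n r = 0" for n
    using a(1) that by (auto simp: fibre_support_def rseqs_def update_eq_add_single tuples_add_iff)
  have "fibre_finite r a"
    unfolding fibre_finite_def using fin supp tuples_iff by simp
  then have "rational (moment r 0 a)" by (rule rational_moment_0[OF a(2)])
  also have "moment r 0 a = a'"
  proof
    fix n
    show "moment r 0 a n = a' n"
    proof (cases "n \<in> tuples r")
      case True
      then have n: "Poly_Mapping.lookup n r = 0" "n \<in> tuples (Suc r)" using tuples_iff by auto
      show ?thesis using supp[OF n(1)] n by (simp add: moment_def a'(2)[OF True] update_eq_add_single)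
    next
      case False
      then have "a' n = 0" using a'(1) by (simp add: rseqs_def)
      then show ?thesis using supp[of n] False tuples_iff[of n] by (auto simp: moment_def)
    qed
  qed
  finally show ?thesis using a'(1) by (simp add: rational_rseq_iff)
qed

lemma rational_contraction:
  fixes a b c :: "mon \<Rightarrow> 'k::field"
  assumes a: "rational_rseq 2 a"
    and fin: "\<And>m. finite {n. a (Poly_Mapping.single 0 m + Poly_Mapping.single 1 n) \<noteq> 0}"
    and b: "rational_rseq 1 b" and c: "c \<in> rseqs 1"
      "\<And>m. c (Poly_Mapping.single 0 m) =
          (\<Sum>n\<in>{n. a (Poly_Mapping.single 0 m + Poly_Mapping.single 1 n) \<noteq> 0}.
             a (Poly_Mapping.single 0 m + Poly_Mapping.single 1 n) * b (Poly_Mapping.single 0 n))"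
  shows "rational_rseq 1 c"
proof (rule rational_sum_over_last)
  let ?f = "\<lambda>n. a n * b (Poly_Mapping.single 0 (Poly_Mapping.lookup n 1))"
  have "?f \<in> rseqs 2" using a by (auto simp: rational_rseq_def rseqs_def)
  then show "rational_rseq (Suc 1) ?f"
    using rational_mult_second_index[OF a b] by (simp add: rational_rseq_iff numeral_2_eq_2)
  fix n :: mon assume "n \<in> tuples 1"
  define m where "m = Poly_Mapping.lookup n 0"
  have n: "n = Poly_Mapping.single 0 m" using \<open>n \<in> tuples 1\<close> tuples_1_iff by (simp add: m_def)
  have f: "?f (Poly_Mapping.update 1 k n)
      = a (Poly_Mapping.single 0 m + Poly_Mapping.single 1 k) * b (Poly_Mapping.single 0 k)" for k
    by (simp add: n update_eq_add_single lookup_add lookup_single)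
  show "finite {k. ?f (Poly_Mapping.update 1 k n) \<noteq> 0}"
    unfolding f by (rule finite_subset[OF _ fin[of m]]) auto
  show "c n = (\<Sum>k\<in>{k. ?f (Poly_Mapping.update 1 k n) \<noteq> 0}. ?f (Poly_Mapping.update 1 k n))"
    unfolding f unfolding n c(2) by (rule sum.mono_neutral_right[OF fin]) auto
qed (rule c(1))

section \<open>The closure properties\<close>

lemma rseqs_extend_by_0:
  assumes "b \<in> rseqs r" "f \<in> rseqs r" "\<forall>n\<in>tuples r. b n = f n"
  shows "b = f"
proof
  show "b n = f n" for n
    using assms by (cases "n \<in> tuples r") (simp_all add: rseqs_def)
qed

theorem theorem1p8:
  fixes r :: nat
  assumes "r \<ge> 1"
  shows
    "(\<forall>a b :: (nat \<Rightarrow>\<^sub>0 nat) \<Rightarrow> 'k::field.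
       (cfinite_rseq r a \<and> rational_rseq r b \<longrightarrow> rational_rseq r (\<lambda>n. a n * b n)) \<and>
       (cfinite_rseq r a \<and> cfinite_rseq r b \<longrightarrow> cfinite_rseq r (\<lambda>n. a n * b n))) \<and>
    (r \<ge> 2 \<longrightarrow> (\<forall>a a' :: (nat \<Rightarrow>\<^sub>0 nat) \<Rightarrow> 'k.
       rational_rseq r a \<and>
       (\<forall>n\<in>tuples (r - 1). finite {m. a (Poly_Mapping.update (r - 1) m n) \<noteq> 0}) \<and>
       a' \<in> rseqs (r - 1) \<and>
       (\<forall>n\<in>tuples (r - 1). a' n =
          (\<Sum>m\<in>{m. a (Poly_Mapping.update (r - 1) m n) \<noteq> 0}. a (Poly_Mapping.update (r - 1) m n)))
       \<longrightarrow> rational_rseq (r - 1) a')) \<and>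
    (\<forall>a b c :: (nat \<Rightarrow>\<^sub>0 nat) \<Rightarrow> 'k.
       rational_rseq 2 a \<and>
       (\<forall>m. finite {n. a (Poly_Mapping.single 0 m + Poly_Mapping.single 1 n) \<noteq> 0}) \<and>
       rational_rseq 1 b \<and>
       c \<in> rseqs 1 \<and>
       (\<forall>m. c (Poly_Mapping.single 0 m) =
          (\<Sum>n\<in>{n. a (Poly_Mapping.single 0 m + Poly_Mapping.single 1 n) \<noteq> 0}.
             a (Poly_Mapping.single 0 m + Poly_Mapping.single 1 n) * b (Poly_Mapping.single 0 n)))
       \<longrightarrow> rational_rseq 1 c) \<and>
    (\<forall>a b :: (nat \<Rightarrow>\<^sub>0 nat) \<Rightarrow> 'k.
       b \<in> rseqs r \<and>
       (\<forall>n\<in>tuples r. b n = (\<Sum>i = 0..Poly_Mapping.lookup n 0. a (Poly_Mapping.update 0 i n))) \<longrightarrow>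
       (rational_rseq r a \<longrightarrow> rational_rseq r b) \<and>
       (cfinite_rseq r a \<longrightarrow> cfinite_rseq r b)) \<and>
    (\<forall>a b :: (nat \<Rightarrow>\<^sub>0 nat) \<Rightarrow> 'k. \<forall>d::nat. d \<ge> 1 \<and>
       b \<in> rseqs r \<and>
       (\<forall>n\<in>tuples r. b n = a (Poly_Mapping.update 0 (d * Poly_Mapping.lookup n 0) n)) \<longrightarrow>
       (rational_rseq r a \<longrightarrow> rational_rseq r b) \<and>
       (cfinite_rseq r a \<longrightarrow> cfinite_rseq r b))"
proof -
  have product: "\<forall>a b :: mon \<Rightarrow> 'k.
       (cfinite_rseq r a \<and> rational_rseq r b \<longrightarrow> rational_rseq r (\<lambda>n. a n * b n)) \<and>
       (cfinite_rseq r a \<and> cfinite_rseq r b \<longrightarrow> cfinite_rseq r (\<lambda>n. a n * b n))"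
    using hadamard_cfinite_rational[of r, unfolded times_eq_lambda]
      hadamard_cfinite[of r, unfolded times_eq_lambda] by blast
  have sums: "(rational_rseq r a \<longrightarrow> rational_rseq r b) \<and> (cfinite_rseq r a \<longrightarrow> cfinite_rseq r b)"
    if b: "b \<in> rseqs r"
      "\<forall>n\<in>tuples r. b n = (\<Sum>i = 0..Poly_Mapping.lookup n 0. a (Poly_Mapping.update 0 i n))"
    for a b :: "mon \<Rightarrow> 'k"
  proof -
    have "b = partial_sums a" if a: "a \<in> rseqs r"
    proof (rule rseqs_extend_by_0[OF b(1)])
      show "partial_sums a \<in> rseqs r"
        using a by (simp add: rseqs_def partial_sums_def update_mem_tuples_iff[OF assms])
      show "\<forall>n\<in>tuples r. b n = partial_sums a n" using b(2) by (simp add: partial_sums_def)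
    qed
    moreover have "a \<in> rseqs r" if "rational_rseq r a \<or> cfinite_rseq r a"
      using that by (auto simp: rational_rseq_def cfinite_rseq_def)
    ultimately show ?thesis
      using b(1) rational_partial_sums[of a] cfinite_partial_sums[OF assms, of a]
      by (auto simp: rational_rseq_iff)
  qed
  have sections: "(rational_rseq r a \<longrightarrow> rational_rseq r b) \<and> (cfinite_rseq r a \<longrightarrow> cfinite_rseq r b)"
    if d: "d \<ge> 1" and b: "b \<in> rseqs r"
      "\<forall>n\<in>tuples r. b n = a (Poly_Mapping.update 0 (d * Poly_Mapping.lookup n 0) n)"
    for a b :: "mon \<Rightarrow> 'k" and d :: nat
  proof -
    have "b = (\<lambda>n. a (stretch d n))" if a: "a \<in> rseqs r"
    proof (rule rseqs_extend_by_0[OF b(1)])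
      show "(\<lambda>n. a (stretch d n)) \<in> rseqs r"
        using a by (simp add: rseqs_def stretch_def update_mem_tuples_iff[OF assms])
      show "\<forall>n\<in>tuples r. b n = a (stretch d n)" using b(2) by (simp add: stretch_def)
    qed
    moreover have "a \<in> rseqs r" if "rational_rseq r a \<or> cfinite_rseq r a"
      using that by (auto simp: rational_rseq_def cfinite_rseq_def)
    ultimately show ?thesis
      using rational_stretch[OF assms d, of a] cfinite_stretch[OF assms d, of a] by auto
  qed
  have Suc_pred: "Suc (r - 1) = r" using assms by simp
  have fibre_sums: "rational_rseq (r - 1) a'"
    if "rational_rseq r a"
      "\<forall>n\<in>tuples (r - 1). finite {m. a (Poly_Mapping.update (r - 1) m n) \<noteq> 0}"
      "a' \<in> rseqs (r - 1)"
      "\<forall>n\<in>tuples (r - 1). a' n =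
          (\<Sum>m\<in>{m. a (Poly_Mapping.update (r - 1) m n) \<noteq> 0}. a (Poly_Mapping.update (r - 1) m n))"
    for a a' :: "mon \<Rightarrow> 'k"
  proof (rule rational_sum_over_last)
    show "rational_rseq (Suc (r - 1)) a" unfolding Suc_pred by (rule that(1))
  qed (use that in simp_all)
  show ?thesis
    apply (intro conjI)
    subgoal by (rule product)
    subgoal by (intro impI allI, elim conjE, rule fibre_sums) assumption+
    subgoal by (intro impI allI, elim conjE, rule rational_contraction) (assumption | erule spec)+
    subgoal by (intro impI allI, elim conjE, rule sums) assumption+
    subgoal by (intro impI allI, elim conjE, rule sections) assumption+
    done
qed

end
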